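(* Consider the problem, the i.i.d. sampling and multiplicative noise assumptions, and Algorithm 1 described in the context. Suppose that $\{\alpha_t\}$ is non-increasing and $$\alpha_t\in\left(0,\frac1L\right),\qquad \beta_t\ge1,\qquad \beta_t^2=\beta_{t+1}^2-\beta_{t+1},\qquad\forall t\in\mathbb{N},$$ and that the sequence $\{y^t,z^t\}$ is generated by Algorithm 1. Let $\mu\in(0,1)$, $a,b,\delta>0$, $N_0\in\mathbb{N}$ and set for all $t\in\mathbb{N}$ $$\beta_t:=\frac{1+t}{2},\qquad \alpha_t:=\frac{\mu}{L+\frac{a}{\sqrt{N_0}}},\qquad N_t:=N_0\left\lceil (t+2+\delta)^3[\ln(t+2+\delta)]^{1+2b}\right\rceil .$$ Choose $\phi\in(0,1)$ and let $t_0:=t_0(\alpha_1\sigma_L,N_0,b,\delta)\in\mathbb{N}$ be given by $$t_0:=\max\left\{\left\lceil \exp\left\{\sqrt[2b]{\frac{15(\alpha_1\sigma_L)^2}{8\phi N_0 b}}\right\}-1-\delta\right\rceil,\,1\right\}.$$ Then the following boundedness result holds with this $t_0$: one has $$\sum_{t=1}^{\infty}\frac{\alpha_{t+1}^2\beta_{t+1}^2}{(1-L\alpha_{t+1})N_{t+1}}<\infty,\qquad \sum_{t\ge t_0}\frac{\alpha_{t+1}^2\beta_{t+1}^2}{(1-L\alpha_{t+1})N_{t+1}}<\frac{1}{15\sigma_L^2},$$ and, for any $\gamma>0$ with $$\sum_{t\ge t_0}\frac{\alpha_{t+1}^2\beta_{t+1}^2}{(1-L\alpha_{t+1})N_{t+1}}<\gamma<\frac{1}{15\sigma_L^2},$$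 for all $x^*\in S(f,\varphi)$, $$\sup_{t\ge 0}\mathbb{E}\left[\|z^t-x^*\|^2\right]\le\frac{\max_{t\in\{1,\dots,t_0\}}\left\{2\alpha_{t_0}\beta_{t_0}^2\,\mathbb{E}[g(z^{t_0})-g^*]+\mathbb{E}[\|s^{t_0}-x^*\|^2]\right\}+\frac{\sigma(x^* )^2}{3\sigma_L^2}}{1-15\gamma\sigma_L^2}.$$ Moreover, given $x^*\in S(f,\varphi)$ and $\mathsf{J}:=\mathsf{J}(x^*,t_0)>0$ such that $\sup_{\tau\in\mathbb{N}}\mathbb{E}[\|z^\tau-x^*\|^2]\le\mathsf{J}$, the following bound holds for all $t\in\mathbb{N}$: $$\begin{aligned}\mathbb{E}\left[g(z^{t+1})-g^*\right]\le{}&\frac{4\,\mathbb{E}[g(z^1)-g^*]}{(t+2)^2}+2\left[\frac{L}{\mu}+\frac{a}{\mu\sqrt{N_0}}\right]\frac{\mathbb{E}[\|s^1-x^*\|^2]}{(t+2)^2}\\&+\left[\frac{L}{\mu}+\frac{a}{\mu\sqrt{N_0}}\right]\cdot\frac{3\mu^2}{4(1-\mu)a^2b[\ln(2+\delta)]^{2b}}\cdot\frac{\sigma(x^* )^2}{(t+2)^2}\\&+\left[\frac{L}{\mu}+\frac{a}{\mu\sqrt{N_0}}\right]\cdot\frac{15\mu^2}{4(1-\mu)N_0b[\ln(2+\delta)]^{2b}}\cdot\frac{(\sigma_L/L)^2\,\mathsf{J}}{(t+2)^2}.\end{aligned}$$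
   Context: Setting. $\mathbb{N}=\{1,2,\dots\}$; $\lceil x\rceil$ is the smallest integer $\ge x$; $\|\cdot\|$ is the Euclidean norm. $X\subset\mathbb{R}^d$ is closed and convex, $\mathbf{P}$ is a probability distribution on $\Xi$, and $F:X\times\Xi\to\mathbb{R}$ is measurable, such that for a.e. $\xi$ the function $F(\cdot,\xi)$ is convex and continuously differentiable, and $F(x,\cdot)$, $\nabla F(x,\cdot)$ are integrable for every $x\in X$. Here $\nabla F$ is the gradient in $x$. Set $f(x):=\mathbb{E}[F(x,\xi)]$ with $\xi\sim\mathbf{P}$; $f$ is convex and differentiable on $X$ with $\nabla f(x)=\mathbb{E}[\nabla F(x,\xi)]$, and for some $L>0$, $\|\nabla f(x)-\nabla f(y)\|\le L\|x-y\|$ for all $x,y\in X$. $\varphi:X\to\mathbb{R}$ is a (possibly nonsmooth) convex function whose proximal minimizations (as in the algorithm below) are well defined. The problem is $g^*:=\min_{x\in X}\{g(x):=f(x)+\varphi(x)\}$, with solution set $S(f,\varphi)$. Multiplicative noise assumption. Let $\sigma(x):=\sqrt{\mathbb{E}[\|\nabla F(x,\xi)-\nabla f(x)\|^2]}$. There is $x^0\in X$ with $\sigma(x^0)<\infty$, and there is $\sigma_L>0$ such that $\sigma(x)\le\sigma(x^* )+\sigma_L\|x-x^*\|$ for all $x,x^*\in X$. Algorithm 1. Inputs: initial points $y^1=z^0\in X$, stepsizes $\alpha_t>0$, weights $\beta_t>0$, batch sizes $N_t\in\mathbb{N}$. At iteration $t\ge1$, given $y^t,z^{t-1}$, draw an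 i.i.d. sample $\xi^t=\{\xi^t_j\}_{j=1}^{N_t}$ from $\mathbf{P}$, independent of all previous samples, put $F'_t(y^t,\xi^t):=\frac1{N_t}\sum_{j=1}^{N_t}\nabla F(y^t,\xi^t_j)$ and $$z^t:=\operatorname*{argmin}_{x\in X}\left\{f(y^t)+\langle F'_t(y^t,\xi^t),x-y^t\rangle+\frac{1}{2\alpha_t}\|x-y^t\|^2+\varphi(x)\right\},\qquad y^{t+1}:=\frac{\beta_t-1}{\beta_{t+1}}(z^t-z^{t-1})+z^t.$$ It is implicit that the points $y^t$ lie in $X$, the domain where $F(\cdot,\xi)$ and $f$ are defined (automatic if $X=\mathbb{R}^d$). For $t\ge1$, $s^t:=\beta_tz^t-(\beta_t-1)z^{t-1}$.
   Formalization: β_t²=β_{t+1}²−β_{t+1}, which contradicts β_t=(1+t)/2, is relaxed to ≥; the bound 1/(15σ_L²) on the sum over t≥t_0 is claimed only for φ≤1−Lα_1 (false in general); inside the max the subscript t_0 is read as t; the supremum is over t≥1, since the bound fails at t=0. *)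

theory Defs
  imports "HOL-Probability.Probability"
begin

(* Expectation of a nonnegative random variable, with values in [0, \<infinity>]; unlike the
   Bochner integral it does not default to 0 when the variable is not integrable. *)
abbreviation nnexp :: "'w measure \<Rightarrow> ('w \<Rightarrow> real) \<Rightarrow> ennreal"
  where "nnexp M h \<equiv> (\<integral>\<^sup>+ \<omega>. ennreal (h \<omega>) \<partial>M)"

(* sigma(x) = sqrt (E |grad F(x, xi) - grad f(x)|^2), which may be infinite. *)
definition noise_sd ::
  "'x measure \<Rightarrow> ('a \<Rightarrow> 'x \<Rightarrow> 'a::euclidean_space) \<Rightarrow> ('a \<Rightarrow> 'a) \<Rightarrow> 'a \<Rightarrow> ennreal"
  where "noise_sd P gradF gradf x =
    (let v = nnexp P (\<lambda>\<xi>. (norm (gradF x \<xi> - gradf x))\<^sup>2)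
     in if v = \<infinity> then \<infinity> else ennreal (sqrt (enn2real v)))"

definition minibatch ::
  "('a \<Rightarrow> 'x \<Rightarrow> 'a::real_vector) \<Rightarrow> nat \<Rightarrow> (nat \<Rightarrow> 'x) \<Rightarrow> 'a \<Rightarrow> 'a"
  where "minibatch gradF n \<xi> y = (1 / real n) *\<^sub>R (\<Sum>j = 1..n. gradF y (\<xi> j))"

definition prox_model ::
  "('a::real_inner \<Rightarrow> real) \<Rightarrow> ('a \<Rightarrow> real) \<Rightarrow> real \<Rightarrow> 'a \<Rightarrow> 'a \<Rightarrow> 'a \<Rightarrow> real"
  where "prox_model f \<phi> \<alpha> y v x =
    f y + inner v (x - y) + 1 / (2 * \<alpha>) * (norm (x - y))\<^sup>2 + \<phi> x"

definition series_term ::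
  "(nat \<Rightarrow> real) \<Rightarrow> (nat \<Rightarrow> real) \<Rightarrow> (nat \<Rightarrow> nat) \<Rightarrow> real \<Rightarrow> nat \<Rightarrow> real"
  where "series_term \<alpha> \<beta> N L t =
    (\<alpha> (t + 1))\<^sup>2 * (\<beta> (t + 1))\<^sup>2 / ((1 - L * \<alpha> (t + 1)) * real (N (t + 1)))"

(* The (2b)-th root of the positive number r is r powr (1 / (2b)); c stands for alpha_1 sigma_L.
   The function nat sends a negative ceiling to 0, which the outer max absorbs. *)
definition burn_in :: "real \<Rightarrow> nat \<Rightarrow> real \<Rightarrow> real \<Rightarrow> real \<Rightarrow> nat"
  where "burn_in c N0 b \<delta> \<phi> =
    max (nat \<lceil>exp ((15 * c\<^sup>2 / (8 * \<phi> * real N0 * b)) powr (1 / (2 * b))) - 1 - \<delta>\<rceil>) 1"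

end

theory Submission
  imports Defs
begin

text \<open>
  The run is an accelerated proximal gradient method with noisy gradients, and the proof follows
  the Lyapunov function
  \[ V_t = 2 \alpha_t \beta_t^2 (g(z^t) - g^*) + \|s^t - x^*\|^2 . \]
  Testing the proximal step against the point at the fraction $1/\beta_t$ of the segment from
  $z^{t-1}$ to $x^*$ makes the distances to $y^t$ and to $z^t$ into
  $\|s^{t-1} - x^*\|/\beta_t$ and $\|s^t - x^*\|/\beta_t$, so that, on every path,
  \[ V_t \le V_{t-1} + \frac{\alpha_t^2 \beta_t^2}{1 - L \alpha_t} \|e_t\|^2
       - 2 \alpha_t \beta_t \langle e_t, s^{t-1} - x^* \rangle \]
  with the gradient error $e_t$ of the batch (\<open>accelerated_prox_step\<close>). The error is centred given
  the past and has second moment $E[\sigma(y^t)^2]/N_t$, because every single sample is independent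
  of everything computed from other samples (\<open>batch_noise_moments\<close>). Taking expectations gives
  $E V_{t+1} \le E V_t + c_t E[\sigma(y^{t+1})^2]$, where $c_t$ is the term of the series in the
  theorem (\<open>lyapunov_step\<close>).

  Multiplicative noise bounds $E[\sigma(y^{t+1})^2]$ by
  $3\sigma(x^*)^2 + 12 \sigma_L^2 E\|z^t - x^*\|^2 + 3 \sigma_L^2 E\|z^{t-1} - x^*\|^2$
  (\<open>query_var_bound\<close>), so the recursion involves the distances that it is meant to control. It
  closes because $z^t$ is a convex combination of $s^t$ and $z^{t-1}$: the largest
  $E\|z^t - x^*\|^2$ up to any time is at most the largest $E V_t$. Beyond $t_0$ the remaining
  coefficients sum to less than $\gamma < 1/(15 \sigma_L^2)$, and the feedback
  $15 \gamma \sigma_L^2 < 1$ can be absorbed (\<open>bounded_by_self_consistent_recursion\<close>). Once the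
  distances are bounded by $J$, summing the recursion from the first iterate and dividing by
  $2 \alpha \beta_{t+1}^2 = \alpha (t+2)^2 / 2$ gives the rate.

  The batch sizes make $c_t$ at most a constant times
  $1 / ((t+3+\delta) \ln^{1+2b}(t+3+\delta))$, whose tails telescope against
  $\ln^{-2b} / (2b)$ (\<open>log_power_tail_step\<close>); all explicit constants come from this.

  The measure theory needs some care. The objective need not be Borel measurable on the domain,
  but it is along the iterates, since a proximal point and its value under \<open>\<phi>\<close> depend continuously on
  the data of the step (\<open>prox_output_measurable\<close>). The gradient oracle is continuous in the point only
  for almost every sample, so it is replaced by a jointly measurable version, and the iterates by
  versions that are frozen at the starting point once a bad sample has been drawn.
\<close>

section \<open>Convex analysis of one proximal step\<close>

lemma segment_has_derivative:
  fixes f :: "'a::euclidean_space \<Rightarrow> real"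
  assumes "convex X" "x \<in> X" "y \<in> X"
    and deriv: "\<And>u. u \<in> X \<Longrightarrow> (f has_derivative (\<lambda>h. inner (gradf u) h)) (at u within X)"
    and t: "0 \<le> t" "t \<le> 1"
  shows "((\<lambda>t. f (y + t *\<^sub>R (x - y))) has_derivative
          (\<lambda>h. h * inner (gradf (y + t *\<^sub>R (x - y))) (x - y))) (at t within {0..1})"
proof -
  let ?p = "\<lambda>t. y + t *\<^sub>R (x - y)"
  have in_X: "?p u \<in> X" if "u \<in> {0..1}" for u
    using convexD_alt[OF assms(1,3,2), of u] that by (simp add: algebra_simps)
  have p: "(?p has_derivative (\<lambda>h. h *\<^sub>R (x - y))) (at t within {0..1})"
    by (auto intro!: derivative_eq_intros)
  have "(f has_derivative (\<lambda>h. inner (gradf (?p t)) h)) (at (?p t) within ?p ` {0..1})"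
    by (rule has_derivative_subset[OF deriv]) (use in_X t in auto)
  from diff_chain_within[OF p this] show ?thesis by (simp add: o_def)
qed

text \<open>
  The derivative is only taken within \<open>X\<close>, so \<open>y\<close> may be a boundary
  point; restricting to the segment from \<open>y\<close> to \<open>x\<close> leaves a one-sided
  derivative at 0, which the chord slope dominates.
\<close>
lemma convex_on_gradient_inequality:
  fixes f :: "'a::euclidean_space \<Rightarrow> real"
  assumes f: "convex_on X f" and x: "x \<in> X" and y: "y \<in> X"
    and deriv: "\<And>u. u \<in> X \<Longrightarrow> (f has_derivative (\<lambda>h. inner (gradf u) h)) (at u within X)"
  shows "f y + inner (gradf y) (x - y) \<le> f x"
proof -
  let ?p = "\<lambda>t. y + t *\<^sub>R (x - y)"
  have X: "convex X" using f by (simp add: convex_on_def)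
  have "((\<lambda>t. f (?p t)) has_field_derivative inner (gradf y) (x - y)) (at 0 within {0..1})"
    using segment_has_derivative[OF X x y deriv, of 0]
    by (simp add: has_field_derivative_def mult.commute[of _ "inner (gradf y) (x - y)"])
  then have "((\<lambda>t. (f (?p t) - f y) / t) \<longlongrightarrow> inner (gradf y) (x - y)) (at 0 within {0..1})"
    by (simp add: has_field_derivative_iff)
  moreover have "eventually (\<lambda>t. (f (?p t) - f y) / t \<le> f x - f y) (at (0::real) within {0..1})"
    unfolding eventually_at_topological
  proof (intro exI[of _ UNIV] conjI ballI impI)
    fix t :: real assume t: "t \<noteq> 0" "t \<in> {0..1}"
    have "f ((1 - t) *\<^sub>R y + t *\<^sub>R x) \<le> (1 - t) * f y + t * f x"
      using convex_onD[OF f, of t y x] t x y by simp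
    also have "(1 - t) *\<^sub>R y + t *\<^sub>R x = ?p t" by (simp add: algebra_simps)
    finally show "(f (?p t) - f y) / t \<le> f x - f y"
      using t by (simp add: field_simps)
  qed auto
  moreover have "at (0::real) within {0..1} \<noteq> bot"
    by (simp add: trivial_limit_within islimpt_Icc)
  ultimately show ?thesis
    using tendsto_upperbound by fastforce
qed

text \<open>
  Subtracting the quadratic model from \<open>f\<close> along the segment leaves a function with
  nonpositive derivative, so the mean value theorem suffices and no integral is needed.
\<close>
lemma descent_lemma:
  fixes f :: "'a::euclidean_space \<Rightarrow> real"
  assumes X: "convex X" and x: "x \<in> X" and y: "y \<in> X"
    and deriv: "\<And>u. u \<in> X \<Longrightarrow> (f has_derivative (\<lambda>h. inner (gradf u) h)) (at u within X)"
    and lip: "\<And>u. u \<in> X \<Longrightarrow> norm (gradf u - gradf y) \<le> L * norm (u - y)"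
  shows "f x \<le> f y + inner (gradf y) (x - y) + L / 2 * (norm (x - y))\<^sup>2"
proof -
  let ?p = "\<lambda>t. y + t *\<^sub>R (x - y)"
  let ?d = "x - y"
  define u where "u t = f (?p t) - t * inner (gradf y) ?d - L / 2 * t\<^sup>2 * (norm ?d)\<^sup>2" for t
  have "(u has_derivative (\<lambda>h. h * inner (gradf (?p t)) ?d - h * inner (gradf y) ?d
           - L * t * h * (norm ?d)\<^sup>2)) (at t within {0..1})" if "0 \<le> t" "t \<le> 1" for t
    unfolding u_def
    by (rule derivative_eq_intros segment_has_derivative[OF X x y deriv] that refl
        | simp add: fun_eq_iff)+
  then obtain t where t: "t \<in> {0<..<1}" "u 1 - u 0 =
      inner (gradf (?p t)) ?d - inner (gradf y) ?d - L * t * (norm ?d)\<^sup>2"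
    using mvt_simple[of 0 1 u "\<lambda>t h. h * inner (gradf (?p t)) ?d - h * inner (gradf y) ?d
           - L * t * h * (norm ?d)\<^sup>2"] by auto
  have "?p t \<in> X"
    using convexD_alt[OF X y x, of t] t by (simp add: algebra_simps)
  have "inner (gradf (?p t) - gradf y) ?d \<le> norm (gradf (?p t) - gradf y) * norm ?d"
    by (rule norm_cauchy_schwarz)
  also have "\<dots> \<le> L * norm (?p t - y) * norm ?d"
    by (rule mult_right_mono[OF lip[OF \<open>?p t \<in> X\<close>]]) simp
  also have "\<dots> = L * t * (norm ?d)\<^sup>2"
    using t by (simp add: power2_eq_square)
  finally have "u 1 - u 0 \<le> 0"
    using t(2) by (simp add: inner_diff_left)
  then show ?thesis by (simp add: u_def)
qed

text \<open>
  Compare the minimiser \<open>z\<close> with \<open>(1 - t) z + t u\<close>, divide by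
  \<open>t\<close> and let \<open>t\<close> tend to 0. Convexity handles \<open>\<phi>\<close>,
  which has no derivative.
\<close>
lemma prox_variational_inequality:
  fixes \<phi> :: "'a::euclidean_space \<Rightarrow> real"
  assumes \<phi>: "convex_on X \<phi>" and \<kappa>: "\<kappa> > 0" and u: "u \<in> X"
    and z: "is_arg_min (prox_model f \<phi> \<kappa> y v) (\<lambda>x. x \<in> X) z"
  shows "\<phi> z \<le> \<phi> u + inner (v + (1 / \<kappa>) *\<^sub>R (z - y)) (u - z)"
proof -
  have X: "convex X" using \<phi> by (simp add: convex_on_def)
  have zX: "z \<in> X" and opt: "prox_model f \<phi> \<kappa> y v z \<le> prox_model f \<phi> \<kappa> y v p" if "p \<in> X" for p
    using z that u by (auto simp: is_arg_min_linorder)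
  let ?A = "\<phi> u - \<phi> z + inner (v + (1 / \<kappa>) *\<^sub>R (z - y)) (u - z)"
  let ?B = "1 / (2 * \<kappa>) * (norm (u - z))\<^sup>2"
  have zX: "z \<in> X" using zX[OF u] .
  have A: "?A = \<phi> u - \<phi> z + inner v (u - z) + inner (z - y) (u - z) / \<kappa>"
    by (simp add: inner_add_left)
  have key: "0 \<le> ?A + t * ?B" if t: "0 < t" "t < 1" for t
  proof -
    let ?p = "(1 - t) *\<^sub>R z + t *\<^sub>R u"
    have pX: "?p \<in> X" using convexD_alt[OF X zX u, of t] t by simp
    have "\<phi> ?p \<le> (1 - t) * \<phi> z + t * \<phi> u"
      using convex_onD[OF \<phi>, of t z u] t zX u by simp
    moreover have *: "?p - y = (z - y) + t *\<^sub>R (u - z)" by (simp add: algebra_simps)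
    have "(norm (?p - y))\<^sup>2 = (norm (z - y))\<^sup>2 + 2 * t * inner (z - y) (u - z) + t\<^sup>2 * (norm (u - z))\<^sup>2"
      unfolding * power2_norm_eq_inner by (simp add: algebra_simps inner_commute power2_eq_square)
    moreover have "inner v (?p - y) = inner v (z - y) + t * inner v (u - z)"
      unfolding * by (simp add: inner_add_right)
    ultimately have "0 \<le> (inner v (z - y) + t * inner v (u - z)
          + 1 / (2 * \<kappa>) * ((norm (z - y))\<^sup>2 + 2 * t * inner (z - y) (u - z) + t\<^sup>2 * (norm (u - z))\<^sup>2)
          + ((1 - t) * \<phi> z + t * \<phi> u)) - (inner v (z - y) + 1 / (2 * \<kappa>) * (norm (z - y))\<^sup>2 + \<phi> z)"
      using opt[OF pX] by (simp add: prox_model_def)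
    also have "\<dots> = t * (?A + t * ?B)"
      unfolding A using \<kappa> by (simp add: field_simps power2_eq_square)
    finally have "0 \<le> t * (?A + t * ?B)" .
    then show ?thesis using t by (simp add: zero_le_mult_iff)
  qed
  have "((\<lambda>t. ?A + t * ?B) \<longlongrightarrow> ?A + 0 * ?B) (at_right 0)"
    by (intro tendsto_intros)
  moreover have "eventually (\<lambda>t. 0 \<le> ?A + t * ?B) (at_right (0::real))"
    by (rule eventually_mono[OF eventually_at_right_real[of 0 1]]) (use key in auto)
  ultimately have "0 \<le> ?A + 0 * ?B"
    by (intro tendsto_lowerbound) auto
  then show ?thesis by simp
qed

text \<open>
  Adding the variational inequalities of the two minimisers, each tested at the other, cancels
  \<open>\<phi>\<close>.
\<close>
lemma prox_nonexpansive:
  fixes \<phi> :: "'a::euclidean_space \<Rightarrow> real"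
  assumes \<phi>: "convex_on X \<phi>" and \<kappa>: "\<kappa> > 0"
    and z: "is_arg_min (prox_model f \<phi> \<kappa> y v) (\<lambda>x. x \<in> X) z"
    and z': "is_arg_min (prox_model f \<phi> \<kappa> y' v') (\<lambda>x. x \<in> X) z'"
  shows "norm (z - z') \<le> norm (y - y') + \<kappa> * norm (v - v')"
proof -
  have "z \<in> X" "z' \<in> X" using z z' by (auto simp: is_arg_min_def)
  have "0 \<le> inner (v + (1 / \<kappa>) *\<^sub>R (z - y)) (z' - z) + inner (v' + (1 / \<kappa>) *\<^sub>R (z' - y')) (z - z')"
    using prox_variational_inequality[OF \<phi> \<kappa> \<open>z' \<in> X\<close> z]
      prox_variational_inequality[OF \<phi> \<kappa> \<open>z \<in> X\<close> z'] by simp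
  also have "\<dots> = (inner ((y - y') - \<kappa> *\<^sub>R (v - v')) (z - z') - inner (z - z') (z - z')) / \<kappa>"
    using \<kappa> by (simp add: inner_add_left inner_diff_left inner_diff_right inner_commute[of z' z] divide_simps)
      (simp add: algebra_simps)
  finally have "inner (z - z') (z - z') \<le> inner ((y - y') - \<kappa> *\<^sub>R (v - v')) (z - z')"
    using \<kappa> by (simp add: zero_le_divide_iff)
  also have "\<dots> \<le> norm ((y - y') - \<kappa> *\<^sub>R (v - v')) * norm (z - z')"
    by (rule norm_cauchy_schwarz)
  finally have "norm (z - z') * norm (z - z') \<le> norm ((y - y') - \<kappa> *\<^sub>R (v - v')) * norm (z - z')"
    by (simp add: power2_norm_eq_inner[symmetric] power2_eq_square)
  then have "norm (z - z') \<le> norm ((y - y') - \<kappa> *\<^sub>R (v - v'))"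
    by (cases "norm (z - z') = 0") (auto simp: mult_le_cancel_right)
  also have "\<dots> \<le> norm (y - y') + \<kappa> * norm (v - v')"
    using norm_triangle_ineq4[of "y - y'" "\<kappa> *\<^sub>R (v - v')"] \<kappa> by simp
  finally show ?thesis .
qed

text \<open>
  A convex function on a closed set need not be Borel measurable (one that vanishes inside a
  disc may take arbitrary nonnegative values on the circle), but it is at proximal points: the
  minimiser depends on the data of the step in a Lipschitz way, and two variational inequalities
  squeeze the difference of the values of \<open>\<phi>\<close>. Both maps are continuous on the
  set of occurring data, which itself may be arbitrary.
\<close>
lemma prox_output_measurable:
  fixes \<phi> :: "'a::euclidean_space \<Rightarrow> real"
  assumes \<phi>: "convex_on X \<phi>" and \<kappa>: "\<kappa> > 0"
    and [measurable]: "Y \<in> borel_measurable K" "V \<in> borel_measurable K"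
    and Z: "\<And>\<omega>. \<omega> \<in> space K \<Longrightarrow> is_arg_min (prox_model f \<phi> \<kappa> (Y \<omega>) (V \<omega>)) (\<lambda>x. x \<in> X) (Z \<omega>)"
  shows "Z \<in> borel_measurable K" and "(\<lambda>\<omega>. \<phi> (Z \<omega>)) \<in> borel_measurable K"
proof -
  let ?W = "\<lambda>\<omega>. (Y \<omega>, V \<omega>)"
  let ?D = "?W ` space K"
  \<comment> \<open>\<open>Z\<close> factors through the data of the step, since equal data have equal
     minimisers.\<close>
  define T where "T d = Z (inv_into (space K) ?W d)" for d
  have T: "is_arg_min (prox_model f \<phi> \<kappa> (fst d) (snd d)) (\<lambda>x. x \<in> X) (T d)" if "d \<in> ?D" for d
  proof -
    let ?o = "inv_into (space K) ?W d"
    have "?o \<in> space K" "?W ?o = d" using that by (rule inv_into_into, rule f_inv_into_f)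
    then show ?thesis using Z[of ?o] unfolding T_def by (metis fst_conv snd_conv)
  qed
  have TX: "T d \<in> X" if "d \<in> ?D" for d using T[OF that] by (simp add: is_arg_min_def)
  have T_eq: "T (?W \<omega>) = Z \<omega>" if "\<omega> \<in> space K" for \<omega>
    using prox_nonexpansive[OF \<phi> \<kappa> T[of "?W \<omega>"] Z[OF that, unfolded fst_conv snd_conv]] that
    by auto
  have T_lim: "(T \<longlongrightarrow> T d) (at d within ?D)" if d: "d \<in> ?D" for d
  proof (rule Lim_null[THEN iffD2], rule Lim_null_comparison)
    show "eventually (\<lambda>e. norm (T e - T d) \<le> norm (fst e - fst d) + \<kappa> * norm (snd e - snd d)) (at d within ?D)"
      unfolding eventually_at_topological
      using prox_nonexpansive[OF \<phi> \<kappa> T T[OF d]] by (intro exI[of _ UNIV]) auto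
    have "((\<lambda>e. norm (fst e - fst d) + \<kappa> * norm (snd e - snd d)) \<longlongrightarrow>
        norm (fst d - fst d) + \<kappa> * norm (snd d - snd d)) (at d within ?D)"
      by (intro tendsto_intros)
    then show "((\<lambda>e. norm (fst e - fst d) + \<kappa> * norm (snd e - snd d)) \<longlongrightarrow> 0) (at d within ?D)"
      by simp
  qed
  then have T_cont: "continuous_on ?D T" by (simp add: continuous_on_def)
  have "((\<lambda>e. \<phi> (T e)) \<longlongrightarrow> \<phi> (T d)) (at d within ?D)" if d: "d \<in> ?D" for d
  proof (rule tendsto_sandwich)
    let ?r = "\<lambda>e. snd e + (1 / \<kappa>) *\<^sub>R (T e - fst e)"
    show "eventually (\<lambda>e. \<phi> (T d) - inner (?r d) (T e - T d) \<le> \<phi> (T e)) (at d within ?D)"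
      unfolding eventually_at_topological
      using prox_variational_inequality[OF \<phi> \<kappa> TX T[OF d]]
      by (intro exI[of _ UNIV]) (auto simp: algebra_simps)
    show "eventually (\<lambda>e. \<phi> (T e) \<le> \<phi> (T d) + inner (?r e) (T d - T e)) (at d within ?D)"
      unfolding eventually_at_topological
      using prox_variational_inequality[OF \<phi> \<kappa> TX[OF d] T]
      by (intro exI[of _ UNIV]) auto
    have "((\<lambda>e. \<phi> (T d) - inner (?r d) (T e - T d)) \<longlongrightarrow> \<phi> (T d) - inner (?r d) (T d - T d)) (at d within ?D)"
      by (intro tendsto_intros T_lim d)
    then show "((\<lambda>e. \<phi> (T d) - inner (?r d) (T e - T d)) \<longlongrightarrow> \<phi> (T d)) (at d within ?D)" by simp
    have "((\<lambda>e. \<phi> (T d) + inner (?r e) (T d - T e)) \<longlongrightarrow> \<phi> (T d) + inner (?r d) (T d - T d)) (at d within ?D)"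
      by (intro tendsto_intros T_lim d)
    then show "((\<lambda>e. \<phi> (T d) + inner (?r e) (T d - T e)) \<longlongrightarrow> \<phi> (T d)) (at d within ?D)" by simp
  qed
  then have \<phi>T_cont: "continuous_on ?D (\<lambda>d. \<phi> (T d))" by (simp add: continuous_on_def)
  have W: "?W \<in> measurable K (restrict_space borel ?D)"
    by (intro measurable_restrict_space2) auto
  have "(\<lambda>\<omega>. T (?W \<omega>)) \<in> borel_measurable K"
    by (rule measurable_compose[OF W borel_measurable_continuous_on_restrict[OF T_cont]])
  then show "Z \<in> borel_measurable K"
    by (rule measurable_cong[THEN iffD1, rotated]) (use T_eq in auto)
  have "(\<lambda>\<omega>. \<phi> (T (?W \<omega>))) \<in> borel_measurable K"
    by (rule measurable_compose[OF W borel_measurable_continuous_on_restrict[OF \<phi>T_cont]])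
  then show "(\<lambda>\<omega>. \<phi> (Z \<omega>)) \<in> borel_measurable K"
    by (rule measurable_cong[THEN iffD1, rotated]) (use T_eq in auto)
qed

text \<open>
  The Lyapunov inequality of one accelerated step with an arbitrary vector \<open>v\<close> in
  place of the gradient. The whole effect of the error \<open>v - gradf y\<close> is one
  quadratic term and one term that is linear in the error and otherwise involves only quantities
  known before \<open>v\<close> is drawn; the latter will have mean zero.
\<close>
lemma accelerated_prox_step:
  fixes f \<phi> :: "'a::euclidean_space \<Rightarrow> real"
  assumes f: "convex_on X f"
    and deriv: "\<And>u. u \<in> X \<Longrightarrow> (f has_derivative (\<lambda>h. inner (gradf u) h)) (at u within X)"
    and lip: "\<And>u w. u \<in> X \<Longrightarrow> w \<in> X \<Longrightarrow> norm (gradf u - gradf w) \<le> L * norm (u - w)"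
    and \<phi>: "convex_on X \<phi>" and \<alpha>: "\<alpha> > 0" "L * \<alpha> < 1" and \<beta>: "\<beta> \<ge> 1"
    and in_X: "y \<in> X" "z \<in> X" "x \<in> X"
    and z': "is_arg_min (prox_model f \<phi> \<alpha> y v) (\<lambda>x. x \<in> X) z'"
    and s: "s = \<beta> *\<^sub>R y - (\<beta> - 1) *\<^sub>R z" and s': "s' = \<beta> *\<^sub>R z' - (\<beta> - 1) *\<^sub>R z"
    and g: "g = (\<lambda>x. f x + \<phi> x)"
  shows "2 * \<alpha> * \<beta>\<^sup>2 * (g z' - g x) + (norm (s' - x))\<^sup>2
    \<le> 2 * \<alpha> * (\<beta>\<^sup>2 - \<beta>) * (g z - g x) + (norm (s - x))\<^sup>2
      + \<alpha>\<^sup>2 * \<beta>\<^sup>2 / (1 - L * \<alpha>) * (norm (v - gradf y))\<^sup>2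
      - 2 * \<alpha> * \<beta> * inner (v - gradf y) (s - x)"
proof -
  have X: "convex X" using f by (simp add: convex_on_def)
  have z'X: "z' \<in> X" using z' by (simp add: is_arg_min_def)
  let ?e = "v - gradf y"
  \<comment> \<open>The test point for which \<open>\<beta> (y - u)\<close> and \<open>\<beta> (z' - u)\<close>
     are \<open>s - x\<close> and \<open>s' - x\<close>.\<close>
  define u where "u = (1 - 1 / \<beta>) *\<^sub>R z + (1 / \<beta>) *\<^sub>R x"
  have uX: "u \<in> X"
    using convexD_alt[OF X in_X(2,3), of "1 / \<beta>"] \<beta> by (simp add: u_def)
  have "g u \<le> (1 - 1 / \<beta>) * g z + (1 / \<beta>) * g x"
    using convex_onD[OF convex_on_add[OF f \<phi>], of "1 / \<beta>" z x] \<beta> in_X by (simp add: u_def g)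
  then have "\<beta>\<^sup>2 * g u \<le> \<beta>\<^sup>2 * ((1 - 1 / \<beta>) * g z + (1 / \<beta>) * g x)"
    by (rule mult_left_mono) simp
  also have "\<dots> = (\<beta>\<^sup>2 - \<beta>) * g z + \<beta> * g x"
    using \<beta> by (simp add: power2_eq_square field_simps)
  finally have gu: "\<beta>\<^sup>2 * g u \<le> (\<beta>\<^sup>2 - \<beta>) * g z + \<beta> * g x" .
  have bu: "\<beta> *\<^sub>R u = (\<beta> - 1) *\<^sub>R z + x"
    using \<beta> by (simp add: u_def scaleR_right_distrib right_diff_distrib)
  have su: "\<beta> *\<^sub>R (y - u) = s - x" "\<beta> *\<^sub>R (z' - u) = s' - x"
    unfolding s s' scaleR_right_diff_distrib bu by (simp_all add: algebra_simps)
  \<comment> \<open>Young's inequality with the weight \<open>1 - L * \<alpha>\<close> that the prox term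
     leaves after paying for the descent lemma.\<close>
  have young: "- 2 * \<alpha> * inner ?e (z' - y)
      \<le> \<alpha>\<^sup>2 / (1 - L * \<alpha>) * (norm ?e)\<^sup>2 + (1 - L * \<alpha>) * (norm (z' - y))\<^sup>2"
  proof -
    define c where "c = 1 - L * \<alpha>"
    have c: "c > 0" using \<alpha> by (simp add: c_def)
    have "0 \<le> (norm ((\<alpha> / c) *\<^sub>R ?e + (z' - y)))\<^sup>2 * c" using c by simp
    also have "(norm ((\<alpha> / c) *\<^sub>R ?e + (z' - y)))\<^sup>2
        = (\<alpha> / c)\<^sup>2 * (norm ?e)\<^sup>2 + (norm (z' - y))\<^sup>2 + 2 * (\<alpha> / c) * inner ?e (z' - y)"
      unfolding power2_norm_eq_inner inner_add_left inner_add_right inner_scaleR_left inner_scaleR_right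
        inner_commute[of "z' - y" ?e]
      using c by (simp add: power2_eq_square field_simps)
    also have "\<dots> * c = \<alpha>\<^sup>2 / c * (norm ?e)\<^sup>2 + c * (norm (z' - y))\<^sup>2 + 2 * \<alpha> * inner ?e (z' - y)"
      using c by (simp add: field_simps power2_eq_square)
    finally have "0 \<le> \<alpha>\<^sup>2 / c * (norm ?e)\<^sup>2 + c * (norm (z' - y))\<^sup>2 + 2 * \<alpha> * inner ?e (z' - y)" .
    then show ?thesis by (simp add: c_def)
  qed
  have "f z' \<le> f y + inner (gradf y) (z' - y) + L / 2 * (norm (z' - y))\<^sup>2"
    by (rule descent_lemma[OF X z'X in_X(1) deriv lip]) (use in_X in auto)
  moreover have "f y + inner (gradf y) (u - y) \<le> f u"
    by (rule convex_on_gradient_inequality[OF f uX in_X(1) deriv])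
  moreover have "\<phi> z' \<le> \<phi> u + inner (v + (1 / \<alpha>) *\<^sub>R (z' - y)) (u - z')"
    by (rule prox_variational_inequality[OF \<phi> \<alpha>(1) uX z'])
  ultimately have "g z' - g u \<le> inner ?e (u - z') + L / 2 * (norm (z' - y))\<^sup>2 + (1 / \<alpha>) * inner (z' - y) (u - z')"
    by (simp add: g inner_add_left inner_diff_left inner_diff_right diff_divide_distrib)
  then have "2 * \<alpha> * (g z' - g u) \<le> 2 * \<alpha> * (inner ?e (u - z') + L / 2 * (norm (z' - y))\<^sup>2 + (1 / \<alpha>) * inner (z' - y) (u - z'))"
    using \<alpha> by (intro mult_left_mono) auto
  also have "\<dots> = 2 * \<alpha> * inner ?e (u - z') + L * \<alpha> * (norm (z' - y))\<^sup>2 + 2 * inner (z' - y) (u - z')"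
    using \<alpha> by (simp add: field_simps)
  also have "2 * inner (z' - y) (u - z') = (norm (y - u))\<^sup>2 - (norm (z' - y))\<^sup>2 - (norm (z' - u))\<^sup>2"
    unfolding power2_norm_eq_inner by (simp add: inner_diff_left inner_diff_right inner_commute)
  also have "inner ?e (u - z') = - inner ?e (z' - y) - inner ?e (y - u)"
    by (simp add: inner_diff_right)
  finally have "2 * \<alpha> * (g z' - g u)
      \<le> \<alpha>\<^sup>2 / (1 - L * \<alpha>) * (norm ?e)\<^sup>2 - 2 * \<alpha> * inner ?e (y - u) + (norm (y - u))\<^sup>2 - (norm (z' - u))\<^sup>2"
    using young by (simp add: algebra_simps)
  then have "\<beta>\<^sup>2 * (2 * \<alpha> * (g z' - g u)) \<le> \<beta>\<^sup>2 * (\<alpha>\<^sup>2 / (1 - L * \<alpha>) * (norm ?e)\<^sup>2 - 2 * \<alpha> * inner ?e (y - u) + (norm (y - u))\<^sup>2 - (norm (z' - u))\<^sup>2)"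
    by (intro mult_left_mono) auto
  also have "\<dots> = \<alpha>\<^sup>2 * \<beta>\<^sup>2 / (1 - L * \<alpha>) * (norm ?e)\<^sup>2 - 2 * \<alpha> * \<beta> * inner ?e (s - x) + (norm (s - x))\<^sup>2 - (norm (s' - x))\<^sup>2"
    unfolding su[symmetric] norm_scaleR power_mult_distrib inner_scaleR_right power2_abs right_diff_distrib
      distrib_left by (simp add: power2_eq_square)
  finally have "\<beta>\<^sup>2 * (2 * \<alpha> * (g z' - g u)) \<le> \<dots>" .
  moreover have "2 * \<alpha> * (\<beta>\<^sup>2 * g u) \<le> 2 * \<alpha> * ((\<beta>\<^sup>2 - \<beta>) * g z + \<beta> * g x)"
    using gu \<alpha> by (intro mult_left_mono) auto
  moreover have "2 * \<alpha> * \<beta>\<^sup>2 * (g z' - g x) = \<beta>\<^sup>2 * (2 * \<alpha> * (g z' - g u)) + 2 * \<alpha> * (\<beta>\<^sup>2 * g u) - 2 * \<alpha> * \<beta>\<^sup>2 * g x"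
    by (simp add: algebra_simps)
  moreover have "2 * \<alpha> * ((\<beta>\<^sup>2 - \<beta>) * g z + \<beta> * g x) - 2 * \<alpha> * \<beta>\<^sup>2 * g x = 2 * \<alpha> * (\<beta>\<^sup>2 - \<beta>) * (g z - g x)"
    by (simp add: algebra_simps)
  ultimately show ?thesis by linarith
qed

section \<open>Sampling noise of a random field at random points\<close>

text \<open>
  Simple functions \<open>r i\<close> converging pointwise to the identity give \<open>G (r i
  y)\<close>, which is jointly measurable because \<open>r i\<close> takes finitely many values,
  and continuity in \<open>y\<close> passes this to the limit.
\<close>
lemma borel_measurable_Caratheodory:
  fixes G :: "'a::euclidean_space \<Rightarrow> 'x \<Rightarrow> 'b::euclidean_space"
  assumes cont: "\<And>\<zeta>. \<zeta> \<in> space P \<Longrightarrow> continuous_on UNIV (\<lambda>y. G y \<zeta>)"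
    and meas: "\<And>y. G y \<in> borel_measurable P"
  shows "(\<lambda>(y, \<zeta>). G y \<zeta>) \<in> borel_measurable (borel \<Otimes>\<^sub>M P)"
proof -
  obtain r :: "nat \<Rightarrow> 'a \<Rightarrow> 'a" where r: "\<And>i. simple_function borel (r i)" "\<And>y. (\<lambda>i. r i y) \<longlonglongrightarrow> y"
    using borel_measurable_implies_sequence_metric[of "\<lambda>y::'a. y" borel 0] by auto
  show ?thesis
  proof (rule borel_measurable_LIMSEQ_metric)
    fix i
    have "(\<lambda>p. G (r i (fst p)) (snd p)) \<in> borel_measurable (borel \<Otimes>\<^sub>M P)"
    proof (rule measurable_compose_countable'[where I = "range (r i)" and g = "\<lambda>p. r i (fst p)" and f = "\<lambda>c p. G c (snd p)"])
      show "(\<lambda>p. r i (fst p)) \<in> measurable (borel \<Otimes>\<^sub>M P) (count_space (range (r i)))"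
        using simple_functionD(1)[OF r(1)[of i]] simple_functionD(2)[OF r(1)[of i]]
        by (intro measurable_compose[OF measurable_fst])
          (auto simp: measurable_count_space_eq2)
    qed (use simple_functionD(1)[OF r(1)[of i]] measurable_compose[OF measurable_snd meas] in \<open>auto simp: countable_finite\<close>)
    then show "(\<lambda>p. G (r i (fst p)) (snd p)) \<in> borel_measurable (borel \<Otimes>\<^sub>M P)" .
  next
    fix p :: "'a \<times> 'x" assume "p \<in> space (borel \<Otimes>\<^sub>M P)"
    then have "continuous_on UNIV (\<lambda>y. G y (snd p))" by (intro cont) (auto simp: space_pair_measure)
    then have "isCont (\<lambda>y. G y (snd p)) (fst p)" by (simp add: continuous_on_eq_continuous_at)
    then have "(\<lambda>i. G (r i (fst p)) (snd p)) \<longlonglongrightarrow> G (fst p) (snd p)"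
      by (rule isCont_tendsto_compose) (rule r(2))
    then show "(\<lambda>i. G (r i (fst p)) (snd p)) \<longlonglongrightarrow> (case p of (y, \<zeta>) \<Rightarrow> G y \<zeta>)"
      by (simp add: case_prod_beta)
  qed
qed

text \<open>
  Projecting onto \<open>X\<close> extends the gradient continuously to the whole space, and
  zeroing it on a null set removes the samples at which it is not continuous. The mean at points
  of \<open>X\<close> does not change.
\<close>
lemma oracle_version_jointly_measurable:
  fixes h :: "'a::euclidean_space \<Rightarrow> 'x \<Rightarrow> 'a"
  assumes X: "closed X" "convex X" "X \<noteq> {}"
    and int: "\<And>x. x \<in> X \<Longrightarrow> integrable P (h x)"
    and bad: "bad \<in> null_sets P"
    and cont: "\<And>\<zeta>. \<zeta> \<in> space P - bad \<Longrightarrow> continuous_on X (\<lambda>x. h x \<zeta>)"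
  defines "G \<equiv> \<lambda>u \<zeta>. if \<zeta> \<in> bad then 0 else h (closest_point X u) \<zeta>"
  shows "(\<lambda>(u, \<zeta>). G u \<zeta>) \<in> borel_measurable (borel \<Otimes>\<^sub>M P)"
    and "integrable P (G u)"
    and "u \<in> X \<Longrightarrow> (LINT \<zeta>|P. G u \<zeta>) = (LINT \<zeta>|P. h u \<zeta>)"
proof -
  have cp: "closest_point X u \<in> X" for u by (rule closest_point_in_set) (use X in auto)
  have h_meas [measurable]: "h (closest_point X u) \<in> borel_measurable P" for u using int[OF cp] by simp
  have bad_sets [measurable]: "bad \<in> sets P" using bad by auto
  have G_meas: "G u \<in> borel_measurable P" for u
    unfolding G_def by measurable
  have AE_eq: "AE \<zeta> in P. G u \<zeta> = h (closest_point X u) \<zeta>" for u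
    using AE_not_in[OF bad] by eventually_elim (simp add: G_def)
  show "(\<lambda>(u, \<zeta>). G u \<zeta>) \<in> borel_measurable (borel \<Otimes>\<^sub>M P)"
  proof (rule borel_measurable_Caratheodory)
    fix \<zeta> assume \<zeta>: "\<zeta> \<in> space P"
    show "continuous_on UNIV (\<lambda>u. G u \<zeta>)"
    proof (cases "\<zeta> \<in> bad")
      case False
      then have "continuous_on UNIV (\<lambda>u. h (closest_point X u) \<zeta>)"
        using \<zeta> X cp by (intro continuous_on_compose2[OF cont continuous_on_closest_point]) auto
      then show ?thesis using False by (simp add: G_def)
    qed (simp add: G_def)
  qed (rule G_meas)
  show "integrable P (G u)"
    using integrable_cong_AE[OF G_meas h_meas AE_eq] int[OF cp] by blast
  show "(LINT \<zeta>|P. G u \<zeta>) = (LINT \<zeta>|P. h u \<zeta>)" if "u \<in> X"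
    using integral_cong_AE[OF G_meas h_meas AE_eq] closest_point_self[OF that] by simp
qed

lemma integrable_inner_of_square_integrable:
  fixes u v :: "'w \<Rightarrow> 'a::euclidean_space"
  assumes [measurable]: "u \<in> borel_measurable M" "v \<in> borel_measurable M"
    and "integrable M (\<lambda>\<omega>. (norm (u \<omega>))\<^sup>2)" "integrable M (\<lambda>\<omega>. (norm (v \<omega>))\<^sup>2)"
  shows "integrable M (\<lambda>\<omega>. inner (u \<omega>) (v \<omega>))"
proof (rule Bochner_Integration.integrable_bound)
  show "integrable M (\<lambda>\<omega>. (norm (u \<omega>))\<^sup>2 + (norm (v \<omega>))\<^sup>2)" using assms by simp
  have "\<bar>inner a b\<bar> \<le> (norm a)\<^sup>2 + (norm b)\<^sup>2" for a b :: 'a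
  proof -
    have "\<bar>inner a b\<bar> \<le> norm a * norm b" by (rule Cauchy_Schwarz_ineq2)
    also have "2 * (norm a * norm b) \<le> (norm a)\<^sup>2 + (norm b)\<^sup>2"
      using sum_squares_bound[of "norm a" "norm b"] by (simp add: mult.assoc)
    then have "norm a * norm b \<le> (norm a)\<^sup>2 + (norm b)\<^sup>2"
      using mult_nonneg_nonneg[OF norm_ge_zero[of a] norm_ge_zero[of b]] by linarith
    finally show ?thesis .
  qed
  then show "AE \<omega> in M. norm (inner (u \<omega>) (v \<omega>)) \<le> norm ((norm (u \<omega>))\<^sup>2 + (norm (v \<omega>))\<^sup>2)"
    by simp
qed simp

text \<open>
  Samples \<open>\<xi> i\<close> that are independent with common law \<open>P\<close>, and a
  random field \<open>G\<close> that is evaluated at random points. \<open>G\<close> is defined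
  and integrable at every point of the space, not only on the domain of an optimisation problem,
  so that no side conditions on the points of evaluation are needed.
\<close>
locale sampled_oracle = prob_space M
  for M :: "'w measure" +
  fixes P :: "'x measure" and \<xi> :: "'i \<Rightarrow> 'w \<Rightarrow> 'x" and I :: "'i set"
    and G :: "'a::euclidean_space \<Rightarrow> 'x \<Rightarrow> 'a"
  assumes P: "prob_space P"
    and indep: "indep_vars (\<lambda>_. P) \<xi> I"
    and distr: "i \<in> I \<Longrightarrow> distr M P (\<xi> i) = P"
    and G_measurable [measurable]: "(\<lambda>(y, \<zeta>). G y \<zeta>) \<in> borel_measurable (borel \<Otimes>\<^sub>M P)"
    and G_integrable: "integrable P (G y)"
begin

definition mean :: "'a \<Rightarrow> 'a" where "mean y = (LINT \<zeta>|P. G y \<zeta>)"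

definition oracle_var :: "'a \<Rightarrow> ennreal" where "oracle_var y = nnexp P (\<lambda>\<zeta>. (norm (G y \<zeta> - mean y))\<^sup>2)"

text \<open>
  The information in the samples indexed by \<open>A\<close>. Indexing by arbitrary sets rather
  than by time allows adding the samples of a batch one by one.
\<close>
definition history :: "'i set \<Rightarrow> 'w measure"
  where "history A = vimage_algebra (space M) (\<lambda>\<omega>. \<lambda>i\<in>A. \<xi> i \<omega>) (PiM A (\<lambda>_. P))"

lemma sample_measurable [measurable]: "i \<in> I \<Longrightarrow> \<xi> i \<in> measurable M P"
  using indep by (auto simp: indep_vars_def)

lemma mean_measurable [measurable]: "mean \<in> borel_measurable borel"
proof -
  interpret P: prob_space P by (rule P)
  show ?thesis unfolding mean_def by measurable
qed

lemma oracle_var_measurable [measurable]: "oracle_var \<in> borel_measurable borel"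
proof -
  interpret P: prob_space P by (rule P)
  show ?thesis unfolding oracle_var_def by measurable
qed

lemma space_history [simp]: "space (history A) = space M"
  by (simp add: history_def)

lemma restrict_samples_measurable: "A \<subseteq> I \<Longrightarrow> (\<lambda>\<omega>. \<lambda>i\<in>A. \<xi> i \<omega>) \<in> measurable M (PiM A (\<lambda>_. P))"
  by (intro measurable_restrict) auto

lemma restrict_samples_history:
  assumes "A \<subseteq> I"
  shows "(\<lambda>\<omega>. \<lambda>i\<in>A. \<xi> i \<omega>) \<in> measurable (history A) (PiM A (\<lambda>_. P))"
  unfolding history_def
  by (rule measurable_vimage_algebra1)
    (use restrict_samples_measurable[OF assms] in \<open>auto dest: measurable_space\<close>)

lemma measurable_history_sample:
  assumes "A \<subseteq> I" "i \<in> A"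
  shows "\<xi> i \<in> measurable (history A) P"
  using measurable_compose[OF restrict_samples_history[OF assms(1)] measurable_component_singleton[OF assms(2)]] assms(2)
  by simp

lemma measurable_history_mono:
  assumes "A \<subseteq> B" "B \<subseteq> I" "W \<in> measurable (history A) N"
  shows "W \<in> measurable (history B) N"
proof -
  have "(\<lambda>\<omega>. \<omega>) \<in> measurable (history B) (history A)"
    unfolding history_def[of A]
  proof (rule measurable_vimage_algebra2)
    show "(\<lambda>\<omega>. \<lambda>i\<in>A. \<xi> i \<omega>) \<in> measurable (history B) (PiM A (\<lambda>_. P))"
      using assms by (intro measurable_restrict measurable_history_sample) auto
  qed auto
  from measurable_compose[OF this assms(3)] show ?thesis .
qed

lemma measurable_history_imp:
  assumes "A \<subseteq> I" "W \<in> measurable (history A) N"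
  shows "W \<in> measurable M N"
proof -
  have "(\<lambda>\<omega>. \<omega>) \<in> measurable M (history A)"
    unfolding history_def
    by (rule measurable_vimage_algebra2[OF _ restrict_samples_measurable[OF assms(1)]]) auto
  from measurable_compose[OF this assms(2)] show ?thesis .
qed

text \<open>
  Stated for events, because \<open>indep_var\<close> relates only random variables with values
  in the same type.
\<close>
lemma history_sample_prob:
  assumes A: "A \<subseteq> I" and i: "i \<in> I" "i \<notin> A" and E: "E \<in> sets (history A)" and C: "C \<in> sets P"
  shows "prob (E \<inter> (\<xi> i -` C \<inter> space M)) = prob E * prob (\<xi> i -` C \<inter> space M)"
proof -
  let ?R = "\<lambda>A \<omega>. \<lambda>i\<in>A. \<xi> i \<omega>"
  have ind: "indep_var (PiM A (\<lambda>_. P)) (?R A) (PiM {i} (\<lambda>_. P)) (?R {i})"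
    using indep_var_restrict[OF indep, of A "{i}"] A i by simp
  have "?R A \<in> space M \<rightarrow> space (PiM A (\<lambda>_. P))"
    using restrict_samples_measurable[OF A] by (auto dest: measurable_space)
  then obtain B where B: "B \<in> sets (PiM A (\<lambda>_. P))" "E = ?R A -` B \<inter> space M"
    using E unfolding history_def by (subst (asm) sets_vimage_algebra2) auto
  \<comment> \<open>The single sample is treated as a family over the index set \<open>{i}\<close>, since
     independence of restrictions is stated for families.\<close>
  define D where "D = (\<lambda>x. x i) -` C \<inter> space (PiM {i} (\<lambda>_. P))"
  have D: "D \<in> sets (PiM {i} (\<lambda>_. P))"
    unfolding D_def using C by measurable
  have \<xi>: "\<xi> i -` C \<inter> space M = ?R {i} -` D \<inter> space M"
    using measurable_space[OF sample_measurable[OF i(1)]] by (auto simp: D_def space_PiM PiE_def)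
  have *: "E \<inter> (\<xi> i -` C \<inter> space M) = (\<lambda>\<omega>. (?R A \<omega>, ?R {i} \<omega>)) -` (B \<times> D) \<inter> space M"
    unfolding \<xi> B(2) by auto
  show ?thesis
    unfolding * unfolding \<xi> B(2) by (rule indep_varD[OF ind B(1) D])
qed

text \<open>
  This lets every expectation over a state \<open>W\<close> computed from the samples in
  \<open>A\<close> and a fresh sample be computed by integrating over the sample first.
\<close>
lemma sample_distr_pair:
  assumes A: "A \<subseteq> I" and i: "i \<in> I" "i \<notin> A" and W: "W \<in> measurable (history A) N"
  shows "distr M (N \<Otimes>\<^sub>M P) (\<lambda>\<omega>. (W \<omega>, \<xi> i \<omega>)) = distr M N W \<Otimes>\<^sub>M P"
proof -
  interpret P: prob_space P by (rule P)
  have [measurable]: "W \<in> measurable M N" "\<xi> i \<in> measurable M P"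
    using measurable_history_imp[OF A W] i by auto
  interpret D: prob_space "distr M N W" by (rule prob_space_distr) simp
  have "distr M N W \<Otimes>\<^sub>M P = distr M (N \<Otimes>\<^sub>M P) (\<lambda>\<omega>. (W \<omega>, \<xi> i \<omega>))"
  proof (rule pair_measure_eqI)
    fix B C assume "B \<in> sets (distr M N W)" and C: "C \<in> sets P"
    then have B: "B \<in> sets N" by simp
    have "prob ((W -` B \<inter> space M) \<inter> (\<xi> i -` C \<inter> space M)) = prob (W -` B \<inter> space M) * prob (\<xi> i -` C \<inter> space M)"
      using history_sample_prob[OF A i _ C] measurable_sets[OF W B] by simp
    moreover have "(W -` B \<inter> space M) \<inter> (\<xi> i -` C \<inter> space M) = (\<lambda>\<omega>. (W \<omega>, \<xi> i \<omega>)) -` (B \<times> C) \<inter> space M"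
      by auto
    ultimately have "emeasure M ((\<lambda>\<omega>. (W \<omega>, \<xi> i \<omega>)) -` (B \<times> C) \<inter> space M)
        = emeasure M (W -` B \<inter> space M) * emeasure M (\<xi> i -` C \<inter> space M)"
      by (simp add: emeasure_eq_measure ennreal_mult)
    moreover have "emeasure M (\<xi> i -` C \<inter> space M) = emeasure P C"
      using emeasure_distr[of "\<xi> i" M P C] C by (simp add: distr[OF i(1)])
    ultimately show "emeasure (distr M N W) B * emeasure P C = emeasure (distr M (N \<Otimes>\<^sub>M P) (\<lambda>\<omega>. (W \<omega>, \<xi> i \<omega>))) (B \<times> C)"
      using B C by (simp add: emeasure_distr)
  qed (auto intro: D.sigma_finite_measure_axioms P.sigma_finite_measure_axioms)
  then show ?thesis by simp
qed

definition noise :: "'i \<Rightarrow> ('w \<Rightarrow> 'a) \<Rightarrow> 'w \<Rightarrow> 'a"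
  where "noise i Y \<omega> = G (Y \<omega>) (\<xi> i \<omega>) - mean (Y \<omega>)"

lemma noise_measurable_history:
  assumes "A \<subseteq> I" "i \<in> A" "Y \<in> borel_measurable (history A)"
  shows "noise i Y \<in> borel_measurable (history A)"
proof -
  note [measurable] = measurable_history_sample[OF assms(1,2)] assms(3)
  show ?thesis unfolding noise_def by measurable
qed

lemma nn_integral_noise:
  assumes A: "A \<subseteq> I" and i: "i \<in> I" "i \<notin> A" and Y: "Y \<in> borel_measurable (history A)"
  shows "nnexp M (\<lambda>\<omega>. (norm (noise i Y \<omega>))\<^sup>2) = (\<integral>\<^sup>+ \<omega>. oracle_var (Y \<omega>) \<partial>M)"
proof -
  interpret P: prob_space P by (rule P)
  have [measurable]: "Y \<in> borel_measurable M" "\<xi> i \<in> measurable M P"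
    using measurable_history_imp[OF A Y] i by auto
  let ?h = "\<lambda>p. ennreal ((norm (G (fst p) (snd p) - mean (fst p)))\<^sup>2)"
  have "nnexp M (\<lambda>\<omega>. (norm (noise i Y \<omega>))\<^sup>2) = (\<integral>\<^sup>+ p. ?h p \<partial>distr M (borel \<Otimes>\<^sub>M P) (\<lambda>\<omega>. (Y \<omega>, \<xi> i \<omega>)))"
    by (subst nn_integral_distr) (auto simp: noise_def)
  also have "\<dots> = (\<integral>\<^sup>+ p. ?h p \<partial>(distr M borel Y \<Otimes>\<^sub>M P))"
    by (simp add: sample_distr_pair[OF A i Y])
  also have "\<dots> = (\<integral>\<^sup>+ y. oracle_var y \<partial>distr M borel Y)"
    by (subst P.nn_integral_fst[symmetric]) (auto simp: oracle_var_def cong: nn_integral_cong)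
  also have "\<dots> = (\<integral>\<^sup>+ \<omega>. oracle_var (Y \<omega>) \<partial>M)"
    by (rule nn_integral_distr) auto
  finally show ?thesis .
qed

lemma integrable_noise:
  assumes A: "A \<subseteq> I" and i: "i \<in> I" "i \<notin> A" and Y: "Y \<in> borel_measurable (history A)"
    and fin: "(\<integral>\<^sup>+ \<omega>. oracle_var (Y \<omega>) \<partial>M) < \<infinity>"
  shows "noise i Y \<in> borel_measurable M" and "integrable M (\<lambda>\<omega>. (norm (noise i Y \<omega>))\<^sup>2)"
    and "(LINT \<omega>|M. (norm (noise i Y \<omega>))\<^sup>2) = enn2real (\<integral>\<^sup>+ \<omega>. oracle_var (Y \<omega>) \<partial>M)"
proof -
  have [measurable]: "Y \<in> borel_measurable M" "\<xi> i \<in> measurable M P"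
    using measurable_history_imp[OF A Y] i by auto
  show [measurable]: "noise i Y \<in> borel_measurable M"
    unfolding noise_def by measurable
  show "integrable M (\<lambda>\<omega>. (norm (noise i Y \<omega>))\<^sup>2)"
    by (rule integrableI_bounded) (use nn_integral_noise[OF A i Y] fin in auto)
  show "(LINT \<omega>|M. (norm (noise i Y \<omega>))\<^sup>2) = enn2real (\<integral>\<^sup>+ \<omega>. oracle_var (Y \<omega>) \<partial>M)"
    by (subst integral_eq_nn_integral) (use nn_integral_noise[OF A i Y] in auto)
qed

text \<open>
  Integrating the fresh sample first, with the state fixed, gives \<open>inner 0 (S
  \<omega>)\<close>. The square integrability of both factors is what makes Fubini applicable.
\<close>
lemma noise_orthogonal:
  assumes A: "A \<subseteq> I" and i: "i \<in> I" "i \<notin> A" and Y: "Y \<in> borel_measurable (history A)"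
    and S: "S \<in> borel_measurable (history A)"
    and fin: "(\<integral>\<^sup>+ \<omega>. oracle_var (Y \<omega>) \<partial>M) < \<infinity>" "integrable M (\<lambda>\<omega>. (norm (S \<omega>))\<^sup>2)"
  shows "integrable M (\<lambda>\<omega>. inner (noise i Y \<omega>) (S \<omega>))"
    and "(LINT \<omega>|M. inner (noise i Y \<omega>) (S \<omega>)) = 0"
proof -
  interpret P: prob_space P by (rule P)
  have [measurable]: "Y \<in> borel_measurable M" "S \<in> borel_measurable M" "\<xi> i \<in> measurable M P"
    using measurable_history_imp[OF A] Y S i by auto
  show int: "integrable M (\<lambda>\<omega>. inner (noise i Y \<omega>) (S \<omega>))"
    by (rule integrable_inner_of_square_integrable)
      (use integrable_noise[OF A i Y fin(1)] fin in auto)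
  let ?W = "\<lambda>\<omega>. (Y \<omega>, S \<omega>)"
  let ?D = "distr M (borel \<Otimes>\<^sub>M borel) ?W"
  let ?h = "\<lambda>p. inner (G (fst (fst p)) (snd p) - mean (fst (fst p))) (snd (fst p))"
  have W: "?W \<in> measurable (history A) (borel \<Otimes>\<^sub>M borel)"
    using Y S by measurable
  interpret D: prob_space ?D by (rule prob_space_distr) measurable
  interpret DP: pair_sigma_finite ?D P ..
  have pair: "distr M ((borel \<Otimes>\<^sub>M borel) \<Otimes>\<^sub>M P) (\<lambda>\<omega>. (?W \<omega>, \<xi> i \<omega>)) = ?D \<Otimes>\<^sub>M P"
    by (rule sample_distr_pair[OF A i W])
  have "integrable (distr M ((borel \<Otimes>\<^sub>M borel) \<Otimes>\<^sub>M P) (\<lambda>\<omega>. (?W \<omega>, \<xi> i \<omega>))) ?h"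
    by (subst integrable_distr_eq) (use int in \<open>auto simp: noise_def\<close>)
  then have int': "integrable (?D \<Otimes>\<^sub>M P) ?h" by (simp only: pair)
  have "(LINT \<omega>|M. inner (noise i Y \<omega>) (S \<omega>)) = (LINT p|distr M ((borel \<Otimes>\<^sub>M borel) \<Otimes>\<^sub>M P) (\<lambda>\<omega>. (?W \<omega>, \<xi> i \<omega>)). ?h p)"
    by (subst integral_distr) (auto simp: noise_def)
  also have "\<dots> = (LINT p|(?D \<Otimes>\<^sub>M P). ?h p)" by (simp only: pair)
  also have "\<dots> = (LINT w|?D. (LINT \<zeta>|P. ?h (w, \<zeta>)))"
    by (rule DP.integral_fst'[OF int', symmetric])
  also have "\<dots> = (LINT w|?D. 0)"
    by (rule Bochner_Integration.integral_cong)
      (auto simp: G_integrable mean_def[symmetric] P.prob_space)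
  finally show "(LINT \<omega>|M. inner (noise i Y \<omega>) (S \<omega>)) = 0" by simp
qed

definition batch_noise :: "'i set \<Rightarrow> ('w \<Rightarrow> 'a) \<Rightarrow> 'w \<Rightarrow> 'a"
  where "batch_noise J Y \<omega> = (1 / real (card J)) *\<^sub>R (\<Sum>i\<in>J. noise i Y \<omega>)"

lemma batch_noise_eq:
  assumes "finite J" "J \<noteq> {}"
  shows "batch_noise J Y \<omega> = (1 / real (card J)) *\<^sub>R (\<Sum>i\<in>J. G (Y \<omega>) (\<xi> i \<omega>)) - mean (Y \<omega>)"
  using assms by (simp add: batch_noise_def noise_def sum_subtractf scaleR_right_diff_distrib sum_constant_scaleR)

text \<open>
  The noises of two samples \<open>i \<noteq> j\<close> of the batch are orthogonal by the same
  lemma that gives orthogonality to \<open>S\<close>: add \<open>j\<close> to the history, and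
  the noise of \<open>j\<close> becomes part of the state. So the second moment of the sum is
  the sum of the second moments, and no joint law of the batch is needed.
\<close>
lemma batch_noise_moments:
  assumes A: "A \<subseteq> I" and J: "J \<subseteq> I" "A \<inter> J = {}" "finite J" "J \<noteq> {}"
    and Y: "Y \<in> borel_measurable (history A)" and S: "S \<in> borel_measurable (history A)"
    and fin: "(\<integral>\<^sup>+ \<omega>. oracle_var (Y \<omega>) \<partial>M) < \<infinity>" "integrable M (\<lambda>\<omega>. (norm (S \<omega>))\<^sup>2)"
  shows "integrable M (\<lambda>\<omega>. (norm (batch_noise J Y \<omega>))\<^sup>2)"
    and "(LINT \<omega>|M. (norm (batch_noise J Y \<omega>))\<^sup>2) = enn2real (\<integral>\<^sup>+ \<omega>. oracle_var (Y \<omega>) \<partial>M) / real (card J)"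
    and "integrable M (\<lambda>\<omega>. inner (batch_noise J Y \<omega>) (S \<omega>))"
    and "(LINT \<omega>|M. inner (batch_noise J Y \<omega>) (S \<omega>)) = 0"
proof -
  let ?n = "real (card J)" and ?v = "enn2real (\<integral>\<^sup>+ \<omega>. oracle_var (Y \<omega>) \<partial>M)"
  have single: "i \<in> I" "i \<notin> A" if "i \<in> J" for i using that J by auto
  note noise = integrable_noise[OF A single Y fin(1)]
  note orth = noise_orthogonal[OF A single Y S fin]
  have cross_int: "integrable M (\<lambda>\<omega>. inner (noise i Y \<omega>) (noise j Y \<omega>))" if "i \<in> J" "j \<in> J" for i j
    by (rule integrable_inner_of_square_integrable) (use noise that in auto)
  have cross: "(LINT \<omega>|M. inner (noise i Y \<omega>) (noise j Y \<omega>)) = (if j = i then ?v else 0)"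
    if ij: "i \<in> J" "j \<in> J" for i j
  proof (cases "i = j")
    case True
    then show ?thesis using noise(3)[OF ij(1) ij(1)] by (simp add: power2_norm_eq_inner)
  next
    case False
    have B: "insert j A \<subseteq> I" using A J ij by auto
    have Y': "Y \<in> borel_measurable (history (insert j A))"
      by (rule measurable_history_mono[OF _ B Y]) auto
    have "(LINT \<omega>|M. inner (noise i Y \<omega>) (noise j Y \<omega>)) = 0"
      by (rule noise_orthogonal(2)[OF B _ _ Y' noise_measurable_history[OF B _ Y'] fin(1) noise(2)])
        (use ij False single in auto)
    then show ?thesis using False by simp
  qed
  have sq: "(norm (batch_noise J Y \<omega>))\<^sup>2 = (1 / ?n)\<^sup>2 * (\<Sum>i\<in>J. \<Sum>j\<in>J. inner (noise i Y \<omega>) (noise j Y \<omega>))" for \<omega>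
    unfolding batch_noise_def norm_scaleR power_mult_distrib power2_norm_eq_inner
    by (subst inner_sum_left, subst inner_sum_right) simp
  show "integrable M (\<lambda>\<omega>. (norm (batch_noise J Y \<omega>))\<^sup>2)"
    unfolding sq using cross_int by (intro integrable_mult_right Bochner_Integration.integrable_sum) auto
  have "(LINT \<omega>|M. (norm (batch_noise J Y \<omega>))\<^sup>2) = (1 / ?n)\<^sup>2 * (\<Sum>i\<in>J. \<Sum>j\<in>J. if j = i then ?v else 0)"
    unfolding sq using cross_int by (simp add: cross Bochner_Integration.integral_sum Bochner_Integration.integrable_sum)
  also have "\<dots> = (1 / ?n)\<^sup>2 * (?n * ?v)"
    using J by (simp add: sum.delta)
  also have "\<dots> = ?v / ?n" using J by (simp add: power2_eq_square)
  finally show "(LINT \<omega>|M. (norm (batch_noise J Y \<omega>))\<^sup>2) = ?v / ?n" .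
  have eq: "inner (batch_noise J Y \<omega>) (S \<omega>) = (1 / ?n) * (\<Sum>i\<in>J. inner (noise i Y \<omega>) (S \<omega>))" for \<omega>
    by (simp add: batch_noise_def inner_sum_left)
  show "integrable M (\<lambda>\<omega>. inner (batch_noise J Y \<omega>) (S \<omega>))"
    unfolding eq using orth(1) by (intro integrable_mult_right Bochner_Integration.integrable_sum) auto
  show "(LINT \<omega>|M. inner (batch_noise J Y \<omega>) (S \<omega>)) = 0"
    unfolding eq using orth by (simp add: Bochner_Integration.integral_sum)
qed

end

section \<open>Logarithmic series and a self-consistent recursion\<close>

text \<open>
  The right-hand side is the integral of \<open>1 / (x ln x powr (1 + 2 * b))\<close> over the
  interval from \<open>u\<close> to \<open>u + 1\<close>, and the left-hand side is the least
  value of this decreasing integrand.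
\<close>
lemma log_power_tail_step:
  fixes b u :: real
  assumes b: "b > 0" and u: "u > 1"
  shows "1 / ((u + 1) * ln (u + 1) powr (1 + 2 * b))
    \<le> (ln u powr (- (2 * b)) - ln (u + 1) powr (- (2 * b))) / (2 * b)"
proof -
  let ?h = "\<lambda>x. ln x powr (- (2 * b))"
  have deriv: "DERIV ?h x :> - (2 * b) * ln x powr (- (2 * b) - 1) * (1 / x)" if "u \<le> x" "x \<le> u + 1" for x
    using DERIV_fun_powr[OF DERIV_ln_divide[of x], of "- (2 * b)"] that u by simp
  obtain x where x: "u < x" "x < u + 1"
    "?h (u + 1) - ?h u = - (2 * b) * ln x powr (- (2 * b) - 1) * (1 / x)"
    using MVT2[of u "u + 1" ?h "\<lambda>x. - (2 * b) * ln x powr (- (2 * b) - 1) * (1 / x)"] deriv by auto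
  have "ln (u + 1) powr (- (2 * b) - 1) / (u + 1) \<le> ln x powr (- (2 * b) - 1) / x"
    using x u b by (intro frac_le powr_mono2') auto
  also have "\<dots> = (?h u - ?h (u + 1)) / (2 * b)"
  proof -
    have "?h u - ?h (u + 1) = 2 * b * (ln x powr (- (2 * b) - 1) / x)" using x(3) by simp
    then show ?thesis using b by simp
  qed
  also have "ln (u + 1) powr (- (2 * b) - 1) = 1 / ln (u + 1) powr (1 + 2 * b)"
  proof -
    have "- (2 * b) - 1 = - (1 + 2 * b)" by simp
    then show ?thesis by (simp only: powr_minus_divide)
  qed
  finally show ?thesis by (simp add: mult.commute)
qed

lemma log_power_tail_sum:
  fixes b \<delta> K :: real
  assumes b: "b > 0" and \<delta>: "\<delta> > 0" and K: "K \<ge> 0"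
    and c: "\<And>t. t \<ge> p \<Longrightarrow> 0 \<le> c t" 
      "\<And>t. t \<ge> p \<Longrightarrow> c t \<le> K / ((real t + 3 + \<delta>) * ln (real t + 3 + \<delta>) powr (1 + 2 * b))"
  shows "c summable_on {p..}"
    and "infsum c {p..} \<le> K / (2 * b * ln (real p + 2 + \<delta>) powr (2 * b))"
proof -
  define h where "h t = ln (real t + 2 + \<delta>) powr (- (2 * b)) / (2 * b)" for t
  have h0: "h t \<ge> 0" for t using b by (simp add: h_def)
  have step: "1 / ((real t + 3 + \<delta>) * ln (real t + 3 + \<delta>) powr (1 + 2 * b)) \<le> h t - h (Suc t)" for t
  proof -
    have "real t + 2 + \<delta> + 1 = real t + 3 + \<delta>" "real (Suc t) + 2 + \<delta> = real t + 3 + \<delta>" by auto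
    then show ?thesis
      using log_power_tail_step[OF b, of "real t + 2 + \<delta>"] \<delta>
      unfolding h_def diff_divide_distrib[symmetric] by (simp only:)
  qed
  have bound: "sum c A \<le> K * h p" if A: "finite A" "A \<subseteq> {p..}" for A
  proof -
    define q where "q = Suc (Max (insert p A))"
    have "x \<le> Max (insert p A)" if "x \<in> insert p A" for x
      using A(1) that by (intro Max_ge) auto
    then have q: "A \<subseteq> {p..<q}" "p \<le> q"
      using A(2) by (force simp: q_def less_Suc_eq_le)+
    have "sum c A \<le> sum c {p..<q}"
      using q c(1) by (intro sum_mono2) auto
    also have "\<dots> \<le> (\<Sum>t = p..<q. K * (h t - h (Suc t)))"
    proof (rule sum_mono)
      fix t assume "t \<in> {p..<q}"
      then have "c t \<le> K * (1 / ((real t + 3 + \<delta>) * ln (real t + 3 + \<delta>) powr (1 + 2 * b)))"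
        using c(2)[of t] by simp
      also have "\<dots> \<le> K * (h t - h (Suc t))"
        using step K by (intro mult_left_mono) auto
      finally show "c t \<le> K * (h t - h (Suc t))" .
    qed
    also have "\<dots> = K * (h p - h q)"
      using sum_Suc_diff'[OF q(2), of "\<lambda>t. - h t"] unfolding sum_distrib_left[symmetric] by simp
    also have "\<dots> \<le> K * h p"
      using K h0[of q] by (intro mult_left_mono) auto
    finally show ?thesis .
  qed
  show sm: "c summable_on {p..}"
    by (rule nonneg_bounded_partial_sums_imp_summable_on[where C = "K * h p"])
      (use c(1) bound in \<open>auto intro!: eventually_finite_subsets_at_top_weakI\<close>)
  have "infsum c {p..} \<le> K * h p"
    by (rule infsum_le_finite_sums[OF sm]) (use bound in auto)
  also have "\<dots> = K / (2 * b * ln (real p + 2 + \<delta>) powr (2 * b))"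
    by (simp add: h_def powr_minus_divide)
  finally show "infsum c {p..} \<le> K / (2 * b * ln (real p + 2 + \<delta>) powr (2 * b))" .
qed

text \<open>
  The bound on \<open>V\<close> depends on the maximum \<open>m\<close> of \<open>D\<close> up
  to time \<open>t\<close>, and \<open>D\<close> is a running convex combination of values of
  \<open>V\<close>. Hence \<open>m \<le> C + \<gamma> * (r + 5 * k * m)\<close>, and since
  \<open>m\<close> is finite, this can be solved for \<open>m\<close>. In the application
  \<open>V\<close> is the expected Lyapunov function and \<open>D\<close> the mean squared
  distance of the iterate to a solution.
\<close>
lemma bounded_by_self_consistent_recursion:
  fixes V D c \<beta> :: "nat \<Rightarrow> real"
  assumes p: "p \<ge> 1"
    and \<beta>: "\<beta> 1 = 1" "\<And>t. t \<ge> 1 \<Longrightarrow> \<beta> t \<ge> 1"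
    and V: "\<And>t. t \<ge> 1 \<Longrightarrow> V (t + 1) \<le> V t + c t * (r + 4 * k * D t + (if t = 1 then 0 else k * D (t - 1)))"
    and D: "\<And>t. D (t + 1) \<le> (1 / \<beta> (t + 1)) * V (t + 1) + (1 - 1 / \<beta> (t + 1)) * D t"
    and nonneg: "\<And>t. D t \<ge> 0" "\<And>t. t \<ge> 1 \<Longrightarrow> c t \<ge> 0" "r \<ge> 0" "k \<ge> 0" "\<gamma> \<ge> 0"
    and C: "\<And>t. 1 \<le> t \<Longrightarrow> t \<le> p \<Longrightarrow> V t \<le> C"
    and \<gamma>: "\<And>q. sum c {p..<q} \<le> \<gamma>" "5 * k * \<gamma> < 1"
    and t: "t \<ge> 1"
  shows "D t \<le> (C + \<gamma> * r) / (1 - 5 * k * \<gamma>)"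
proof -
  define m where "m = Max (D ` {1..t})"
  have Dm: "D \<tau> \<le> m" if "\<tau> \<in> {1..t}" for \<tau>
    unfolding m_def using that by (intro Max_ge) auto
  have m0: "m \<ge> 0" using Dm[of 1] nonneg(1)[of 1] t by auto
  define K where "K = C + \<gamma> * (r + 5 * k * m)"
  have rk: "r + 5 * k * m \<ge> 0" using nonneg m0 by simp
  have CK: "C \<le> K" using rk nonneg by (simp add: K_def)
  \<comment> \<open>From time \<open>p\<close> on, every increment of \<open>V\<close> is at most \<open>c * (r
     + 5 * k * m)\<close>; for \<open>p + n = 1\<close> the missing summand stands for a time
     outside the range of \<open>m\<close>.\<close>
  have tail: "V (p + n) \<le> C + sum c {p..<p + n} * (r + 5 * k * m)" if "p + n \<le> t" for n
    using that
  proof (induction n)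
    case 0 then show ?case using C[of p] p by simp
  next
    case (Suc n)
    have prev: "D (p + n - 1) \<le> m" if "p + n \<noteq> 1"
      using Suc.prems p that by (intro Dm) auto
    have "4 * k * D (p + n) + (if p + n = 1 then 0 else k * D (p + n - 1)) \<le> 4 * k * m + k * m"
      using Suc.prems p Dm[of "p + n"] prev nonneg m0
      by (intro add_mono) (auto intro!: mult_left_mono)
    then have "r + 4 * k * D (p + n) + (if p + n = 1 then 0 else k * D (p + n - 1)) \<le> r + 5 * k * m" by simp
    then have "c (p + n) * (r + 4 * k * D (p + n) + (if p + n = 1 then 0 else k * D (p + n - 1))) \<le> c (p + n) * (r + 5 * k * m)"
      using nonneg(2)[of "p + n"] p by (intro mult_left_mono) auto
    then have "V (p + n + 1) \<le> V (p + n) + c (p + n) * (r + 5 * k * m)"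
      using V[of "p + n"] p by simp
    also have "\<dots> \<le> C + sum c {p..<p + n} * (r + 5 * k * m) + c (p + n) * (r + 5 * k * m)"
      using Suc by simp
    finally show ?case by (simp add: algebra_simps)
  qed
  have VK: "V \<tau> \<le> K" if \<tau>: "1 \<le> \<tau>" "\<tau> \<le> t" for \<tau>
  proof (cases "\<tau> \<le> p")
    case True then show ?thesis using C[of \<tau>] \<tau> CK by simp
  next
    case False
    then have "V \<tau> \<le> C + sum c {p..<\<tau>} * (r + 5 * k * m)" using tail[of "\<tau> - p"] \<tau> by simp
    also have "\<dots> \<le> K" unfolding K_def using \<gamma>(1) rk by (intro add_left_mono mult_right_mono) auto
    finally show ?thesis .
  qed
  have DK: "D (Suc n) \<le> K" if "Suc n \<le> t" for n
    using that
  proof (induction n)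
    case 0 then show ?case using D[of 0] \<beta>(1) VK[of 1] by simp
  next
    case (Suc n)
    let ?q = "1 / \<beta> (Suc n + 1)"
    have q: "0 \<le> ?q" "?q \<le> 1" using \<beta>(2)[of "Suc n + 1"] by auto
    have "D (Suc n + 1) \<le> ?q * V (Suc n + 1) + (1 - ?q) * D (Suc n)" by (rule D)
    also have "\<dots> \<le> ?q * K + (1 - ?q) * K"
      using q VK[of "Suc n + 1"] Suc by (intro add_mono mult_left_mono) auto
    finally show ?case by (simp add: algebra_simps)
  qed
  have "m \<in> D ` {1..t}" unfolding m_def using t by (intro Max_in) auto
  then obtain n where n: "m = D n" "1 \<le> n" "n \<le> t" by auto
  then have "m \<le> K" using DK[of "n - 1"] by simp
  then have "m * (1 - 5 * k * \<gamma>) \<le> C + \<gamma> * r"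
    by (simp add: K_def algebra_simps)
  then have "m \<le> (C + \<gamma> * r) / (1 - 5 * k * \<gamma>)"
    using \<gamma>(2) by (simp add: pos_le_divide_eq)
  then show ?thesis using Dm[of t] t by simp
qed

text \<open>
  The factor \<open>(t + 3 + \<delta>) ^ 3\<close> in the batch size beats \<open>(\<beta> (t +
  1))\<^sup>2 = (t + 2)\<^sup>2 / 4\<close> by one power, which leaves a summable logarithmic
  series.
\<close>
lemma series_term_tail:
  fixes A b \<delta> L :: real and N0 p :: nat
  assumes A: "A > 0" "L * A < 1" and b: "b > 0" and \<delta>: "\<delta> > 0" and N0: "N0 \<ge> 1"
    and \<alpha>: "\<And>t. 1 \<le> t \<Longrightarrow> \<alpha> t = A" and \<beta>: "\<And>t. 1 \<le> t \<Longrightarrow> \<beta> t = (1 + real t) / 2"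
    and N: "\<And>t. 1 \<le> t \<Longrightarrow> N t = N0 * nat \<lceil>(real t + 2 + \<delta>) ^ 3 * (ln (real t + 2 + \<delta>)) powr (1 + 2 * b)\<rceil>"
  shows "series_term \<alpha> \<beta> N L t \<ge> 0"
    and "series_term \<alpha> \<beta> N L summable_on {p..}"
    and "infsum (series_term \<alpha> \<beta> N L) {p..} \<le> A\<^sup>2 / (8 * (1 - L * A) * real N0 * b * ln (real p + 2 + \<delta>) powr (2 * b))"
proof -
  define K where "K = A\<^sup>2 / (4 * (1 - L * A) * real N0)"
  have K: "K \<ge> 0" using A N0 by (simp add: K_def)
  show nonneg: "series_term \<alpha> \<beta> N L t \<ge> 0" for t
    using A by (simp add: series_term_def \<alpha>)
  have bound: "series_term \<alpha> \<beta> N L t \<le> K / ((real t + 3 + \<delta>) * ln (real t + 3 + \<delta>) powr (1 + 2 * b))" for t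
  proof -
    define v where "v = real t + 3 + \<delta>"
    define l where "l = ln v powr (1 + 2 * b)"
    have v: "v > 1" "real t + 2 \<le> v" using \<delta> by (auto simp: v_def)
    have l: "l > 0" using v by (simp add: l_def)
    have "v ^ 3 * l \<le> real (nat \<lceil>v ^ 3 * l\<rceil>)" by (rule real_nat_ceiling_ge)
    then have "real N0 * (v ^ 3 * l) \<le> real N0 * real (nat \<lceil>v ^ 3 * l\<rceil>)" by (rule mult_left_mono) simp
    also have "\<dots> = real (N (t + 1))"
      using N[of "t + 1"] by (simp add: v_def l_def add_ac)
    finally have NN: "real N0 * (v ^ 3 * l) \<le> real (N (t + 1))" .
    have at_t: "\<alpha> (t + 1) = A" "\<beta> (t + 1) = (real t + 2) / 2"
      using \<alpha>[of "t + 1"] \<beta>[of "t + 1"] by simp_all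
    have "series_term \<alpha> \<beta> N L t = (A\<^sup>2 * (real t + 2)\<^sup>2 / 4) / ((1 - L * A) * real (N (t + 1)))"
      unfolding series_term_def at_t by (simp add: power_divide)
    also have "\<dots> \<le> (A\<^sup>2 * v\<^sup>2 / 4) / ((1 - L * A) * (real N0 * (v ^ 3 * l)))"
      using A v l N0 NN by (intro frac_le divide_right_mono mult_left_mono power_mono mult_pos_pos) auto
    also have "\<dots> = K / (v * l)"
      using A v l N0 by (simp add: K_def field_simps power2_eq_square power3_eq_cube)
    finally show ?thesis by (simp add: v_def l_def)
  qed
  note tail = log_power_tail_sum[of b \<delta> K p "series_term \<alpha> \<beta> N L", OF b \<delta> K nonneg bound]
  show "series_term \<alpha> \<beta> N L summable_on {p..}" by (rule tail(1))
  have "K / (2 * b * ln (real p + 2 + \<delta>) powr (2 * b)) = A\<^sup>2 / (8 * (1 - L * A) * real N0 * b * ln (real p + 2 + \<delta>) powr (2 * b))"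
    by (simp add: K_def mult_ac)
  with tail(2) show "infsum (series_term \<alpha> \<beta> N L) {p..} \<le> A\<^sup>2 / (8 * (1 - L * A) * real N0 * b * ln (real p + 2 + \<delta>) powr (2 * b))"
    by simp
qed

text \<open>
  The burn-in time is chosen exactly so that the tail bound of the series falls below \<open>1 /
  (15 * \<sigma>\<^sub>L\<^sup>2)\<close>. The inequality is strict since the ceiling leaves a
  margin of 1 inside the logarithm.
\<close>
lemma burn_in_log_power:
  assumes c: "c > 0" and N0: "N0 \<ge> 1" and b: "b > 0" and \<theta>: "\<theta> > 0" and \<delta>: "\<delta> > 0"
  shows "15 * c\<^sup>2 / (8 * \<theta> * real N0 * b) < ln (real (burn_in c N0 b \<delta> \<theta>) + 2 + \<delta>) powr (2 * b)"
proof -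
  define r where "r = 15 * c\<^sup>2 / (8 * \<theta> * real N0 * b)"
  have r: "r > 0" using assms by (simp add: r_def)
  let ?e = "exp (r powr (1 / (2 * b)))"
  have "?e - 1 - \<delta> \<le> real (nat \<lceil>?e - 1 - \<delta>\<rceil>)" by (rule real_nat_ceiling_ge)
  also have "\<dots> \<le> real (burn_in c N0 b \<delta> \<theta>)" by (simp add: burn_in_def r_def)
  finally have "?e < real (burn_in c N0 b \<delta> \<theta>) + 2 + \<delta>" by simp
  then have "r powr (1 / (2 * b)) < ln (real (burn_in c N0 b \<delta> \<theta>) + 2 + \<delta>)"
    using ln_less_cancel_iff[of ?e "real (burn_in c N0 b \<delta> \<theta>) + 2 + \<delta>"] \<delta> by simp
  then have "(r powr (1 / (2 * b))) powr (2 * b) < ln (real (burn_in c N0 b \<delta> \<theta>) + 2 + \<delta>) powr (2 * b)"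
    using b by (intro powr_less_mono2) auto
  moreover have "(r powr (1 / (2 * b))) powr (2 * b) = r"
    using b r by (simp add: powr_powr)
  ultimately have "r < ln (real (burn_in c N0 b \<delta> \<theta>) + 2 + \<delta>) powr (2 * b)" by simp
  then show ?thesis by (simp only: r_def)
qed

text \<open>
  The two bounds on \<open>A\<^sup>2\<close> come from dropping either summand of the
  denominator; they give the two noise terms of the convergence rate, of order
  \<open>\<mu>\<^sup>2 / a\<^sup>2\<close> and \<open>\<mu>\<^sup>2 / (N0 * L\<^sup>2)\<close>.
\<close>
lemma stepsize_bounds:
  fixes \<mu> L a :: real and N0 :: nat
  assumes \<mu>: "0 < \<mu>" and L: "L > 0" and a: "a > 0" and N0: "N0 \<ge> 1"
  defines "A \<equiv> \<mu> / (L + a / sqrt (real N0))"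
  shows "A > 0" "L * A \<le> \<mu>" "A\<^sup>2 \<le> \<mu>\<^sup>2 * real N0 / a\<^sup>2" "A\<^sup>2 \<le> \<mu>\<^sup>2 / L\<^sup>2"
    "1 / A = L / \<mu> + a / (\<mu> * sqrt (real N0))"
proof -
  define q where "q = a / sqrt (real N0)"
  have q: "q > 0" using a N0 by (simp add: q_def)
  have A: "A = \<mu> / (L + q)" by (simp add: A_def q_def)
  show A0: "A > 0" using \<mu> L q by (simp add: A)
  have AL: "A \<le> \<mu> / L" unfolding A using \<mu> L q by (intro divide_left_mono) auto
  then show "L * A \<le> \<mu>" using L by (simp add: field_simps)
  have "A\<^sup>2 \<le> (\<mu> / L)\<^sup>2" using AL A0 by (intro power_mono) auto
  then show "A\<^sup>2 \<le> \<mu>\<^sup>2 / L\<^sup>2" by (simp add: power_divide)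
  have "A \<le> \<mu> / q" unfolding A using \<mu> L q by (intro divide_left_mono) auto
  then have "A\<^sup>2 \<le> (\<mu> / q)\<^sup>2" using A0 by (intro power_mono) auto
  also have "\<dots> = \<mu>\<^sup>2 * real N0 / a\<^sup>2" by (simp add: q_def power_divide power_mult_distrib)
  finally show "A\<^sup>2 \<le> \<mu>\<^sup>2 * real N0 / a\<^sup>2" .
  show "1 / A = L / \<mu> + a / (\<mu> * sqrt (real N0))"
    using \<mu> by (simp add: A_def add_divide_distrib)
qed

section \<open>The Lyapunov recursion of an accelerated run\<close>

text \<open>
  One run of the algorithm. The iterates use \<open>gradF\<close>; \<open>G\<close> is its
  jointly measurable version, equal to it on \<open>X\<close> outside the null set
  \<open>bad\<close> of samples. The measurability of the iterates is not assumed, and it may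
  fail on a null set.
\<close>
locale accelerated_run =
  sampled_oracle M P "\<lambda>(t, j). \<xi> t j" "{(t, j). 1 \<le> t \<and> 1 \<le> j \<and> j \<le> N t}" G
  for M :: "'w measure" and P :: "'x measure" and \<xi> :: "nat \<Rightarrow> nat \<Rightarrow> 'w \<Rightarrow> 'x"
    and N :: "nat \<Rightarrow> nat" and G :: "'a::euclidean_space \<Rightarrow> 'x \<Rightarrow> 'a" +
  fixes X :: "'a set" and f \<phi> :: "'a \<Rightarrow> real" and gradf :: "'a \<Rightarrow> 'a"
    and gradF :: "'a \<Rightarrow> 'x \<Rightarrow> 'a" and bad :: "'x set"
    and L :: real and \<alpha> \<beta> :: "nat \<Rightarrow> real" and z0 :: 'a and y z :: "nat \<Rightarrow> 'w \<Rightarrow> 'a"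
  assumes bad_null: "bad \<in> null_sets P"
    and G_eq: "u \<in> X \<Longrightarrow> \<zeta> \<in> space P - bad \<Longrightarrow> G u \<zeta> = gradF u \<zeta>"
    and G_mean: "u \<in> X \<Longrightarrow> (LINT \<zeta>|P. G u \<zeta>) = gradf u"
    and f_convex: "convex_on X f" and \<phi>_convex: "convex_on X \<phi>"
    and f_deriv: "u \<in> X \<Longrightarrow> (f has_derivative (\<lambda>h. inner (gradf u) h)) (at u within X)"
    and f_smooth: "u \<in> X \<Longrightarrow> u' \<in> X \<Longrightarrow> norm (gradf u - gradf u') \<le> L * norm (u - u')"
    and \<alpha>_pos: "1 \<le> t \<Longrightarrow> \<alpha> t > 0" and \<alpha>_less: "1 \<le> t \<Longrightarrow> L * \<alpha> t < 1"
    and \<alpha>_decreasing: "1 \<le> t \<Longrightarrow> \<alpha> (t + 1) \<le> \<alpha> t"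
    and \<beta>_1: "\<beta> 1 = 1" and \<beta>_ge_1: "1 \<le> t \<Longrightarrow> \<beta> t \<ge> 1"
    and \<beta>_rec: "1 \<le> t \<Longrightarrow> (\<beta> (t + 1))\<^sup>2 - \<beta> (t + 1) \<le> (\<beta> t)\<^sup>2"
    and N_pos: "1 \<le> t \<Longrightarrow> N t \<ge> 1"
    and z0: "z0 \<in> X" and z_init: "\<omega> \<in> space M \<Longrightarrow> z 0 \<omega> = z0" and y_init: "\<omega> \<in> space M \<Longrightarrow> y 1 \<omega> = z0"
    and y_in_X: "1 \<le> t \<Longrightarrow> \<omega> \<in> space M \<Longrightarrow> y t \<omega> \<in> X"
    and z_step: "1 \<le> t \<Longrightarrow> \<omega> \<in> space M \<Longrightarrow>
          is_arg_min (prox_model f \<phi> (\<alpha> t) (y t \<omega>) (minibatch gradF (N t) (\<lambda>j. \<xi> t j \<omega>) (y t \<omega>)))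
            (\<lambda>x. x \<in> X) (z t \<omega>)"
    and y_step: "1 \<le> t \<Longrightarrow> \<omega> \<in> space M \<Longrightarrow>
          y (t + 1) \<omega> = ((\<beta> t - 1) / \<beta> (t + 1)) *\<^sub>R (z t \<omega> - z (t - 1) \<omega>) + z t \<omega>"
begin

abbreviation index :: "(nat \<times> nat) set"
  where "index \<equiv> {(t, j). 1 \<le> t \<and> 1 \<le> j \<and> j \<le> N t}"

definition past :: "nat \<Rightarrow> (nat \<times> nat) set" where "past t = {(\<tau>, j) \<in> index. \<tau> \<le> t}"

definition batch :: "nat \<Rightarrow> (nat \<times> nat) set" where "batch t = Pair t ` {1..N t}"

definition good :: "nat \<Rightarrow> 'w \<Rightarrow> bool" where "good t \<omega> \<longleftrightarrow> (\<forall>(\<tau>, j) \<in> past t. \<xi> \<tau> j \<omega> \<notin> bad)"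

text \<open>
  The iterates and query points agree with these versions as long as no bad sample has been
  drawn. The query point \<open>y t\<close> is computed from the samples of the first \<open>t -
  1\<close> batches, so that only these may be inspected.
\<close>
definition z_version :: "nat \<Rightarrow> 'w \<Rightarrow> 'a" where "z_version t \<omega> = (if good t \<omega> then z t \<omega> else z0)"

definition y_version :: "nat \<Rightarrow> 'w \<Rightarrow> 'a" where "y_version t \<omega> = (if good (t - 1) \<omega> then y t \<omega> else z0)"

text \<open>
  For \<open>t \<ge> 1\<close> the point \<open>s\<^sup>t\<close> of the algorithm. The value at
  0 makes the one-step inequality hold from the first step on.
\<close>
definition momentum :: "(nat \<Rightarrow> 'w \<Rightarrow> 'a) \<Rightarrow> nat \<Rightarrow> 'w \<Rightarrow> 'a"
  where "momentum w t \<omega> = (if t = 0 then z0 else \<beta> t *\<^sub>R w t \<omega> - (\<beta> t - 1) *\<^sub>R w (t - 1) \<omega>)"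

definition g :: "'a \<Rightarrow> real" where "g u = f u + \<phi> u"

lemma z_in_X: "\<omega> \<in> space M \<Longrightarrow> z t \<omega> \<in> X"
  using z_step[of t \<omega>] z_init[of \<omega>] z0 by (cases t) (auto simp: is_arg_min_def)

lemma z_version_in_X: "\<omega> \<in> space M \<Longrightarrow> z_version t \<omega> \<in> X"
  using z_in_X z0 by (simp add: z_version_def)

lemma y_version_in_X: "1 \<le> t \<Longrightarrow> \<omega> \<in> space M \<Longrightarrow> y_version t \<omega> \<in> X"
  using y_in_X z0 by (simp add: y_version_def)

lemma past_mono: "t \<le> t' \<Longrightarrow> past t \<subseteq> past t'"
  by (auto simp: past_def)

lemma past_index: "past t \<subseteq> index"
  by (auto simp: past_def)

lemma finite_past: "finite (past t)"
  by (rule finite_subset[of _ "SIGMA \<tau>:{1..t}. {1..N \<tau>}"]) (auto simp: past_def)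

lemma good_mono: "t \<le> t' \<Longrightarrow> good t' \<omega> \<Longrightarrow> good t \<omega>"
  using past_mono by (fastforce simp: good_def)

lemma AE_good: "AE \<omega> in M. \<forall>t. good t \<omega>"
proof -
  have "AE \<omega> in M. \<forall>i. i \<in> index \<longrightarrow> (case i of (t, j) \<Rightarrow> \<xi> t j) \<omega> \<notin> bad"
    unfolding AE_all_countable
  proof (intro allI)
    fix i show "AE \<omega> in M. i \<in> index \<longrightarrow> (case i of (t, j) \<Rightarrow> \<xi> t j) \<omega> \<notin> bad"
    proof (cases "i \<in> index")
      case True
      have "AE \<zeta> in distr M P (case i of (t, j) \<Rightarrow> \<xi> t j). \<zeta> \<notin> bad"
        unfolding distr[OF True] by (rule AE_not_in[OF bad_null])
      from AE_distrD[OF sample_measurable[OF True] this] show ?thesis by auto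
    qed simp
  qed
  then show ?thesis
    by (rule AE_mp) (auto simp: good_def past_def intro!: AE_I2)
qed

lemma z_version_eq: "good t' \<omega> \<Longrightarrow> t \<le> t' \<Longrightarrow> z_version t \<omega> = z t \<omega>"
  using good_mono by (simp add: z_version_def)

lemma y_version_eq: "good t' \<omega> \<Longrightarrow> t - 1 \<le> t' \<Longrightarrow> y_version t \<omega> = y t \<omega>"
  using good_mono by (simp add: y_version_def)

lemma momentum_eq: "good t \<omega> \<Longrightarrow> momentum z_version t \<omega> = momentum z t \<omega>"
  by (simp add: momentum_def z_version_eq)

lemma AE_z_version: "AE \<omega> in M. \<forall>t. z_version t \<omega> = z t \<omega> \<and> y_version t \<omega> = y t \<omega> \<and> momentum z_version t \<omega> = momentum z t \<omega>"
  using AE_good by eventually_elim (auto intro: z_version_eq y_version_eq momentum_eq)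

lemma good_measurable: "{\<omega> \<in> space (history (past t)). good t \<omega>} \<in> sets (history (past t))"
proof -
  have "{\<omega> \<in> space (history (past t)). (case i of (\<tau>, j) \<Rightarrow> \<xi> \<tau> j) \<omega> \<notin> bad} \<in> sets (history (past t))"
    if "i \<in> past t" for i
  proof -
    have [measurable]: "(case i of (\<tau>, j) \<Rightarrow> \<xi> \<tau> j) \<in> measurable (history (past t)) P"
      by (rule measurable_history_sample[OF past_index that])
    have [measurable]: "bad \<in> sets P" using bad_null by auto
    show ?thesis by measurable
  qed
  then have "{\<omega> \<in> space (history (past t)). \<forall>i\<in>past t. (case i of (\<tau>, j) \<Rightarrow> \<xi> \<tau> j) \<omega> \<notin> bad} \<in> sets (history (past t))"
    by (intro sets.sets_Collect_finite_All finite_past) auto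
  moreover have "good t = (\<lambda>\<omega>. \<forall>i\<in>past t. (case i of (\<tau>, j) \<Rightarrow> \<xi> \<tau> j) \<omega> \<notin> bad)"
    by (auto simp: good_def fun_eq_iff)
  ultimately show ?thesis by simp
qed

lemma minibatch_eq_G:
  assumes "1 \<le> t" "\<omega> \<in> space M" "good t \<omega>"
  shows "minibatch gradF (N t) (\<lambda>j. \<xi> t j \<omega>) (y t \<omega>) = minibatch G (N t) (\<lambda>j. \<xi> t j \<omega>) (y_version t \<omega>)"
proof -
  have "y_version t \<omega> = y t \<omega>" using assms(3) by (rule y_version_eq) simp
  moreover have "G (y t \<omega>) (\<xi> t j \<omega>) = gradF (y t \<omega>) (\<xi> t j \<omega>)" if "j \<in> {1..N t}" for j
  proof (rule G_eq[OF y_in_X])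
    have i: "(t, j) \<in> past t" using that assms(1) by (auto simp: past_def)
    then have "(t, j) \<in> index" using past_index by blast
    from measurable_space[OF sample_measurable[OF this] assms(2)]
    show "\<xi> t j \<omega> \<in> space P - bad" using assms(3) i by (auto simp: good_def)
  qed (use assms in auto)
  ultimately show ?thesis by (simp add: minibatch_def)
qed

text \<open>
  All three by one induction: the new iterate is a proximal point for the old query point and
  the new batch, and the next query point is an affine combination of the last two iterates. On
  the complement of the good event everything is constant, and the good event belongs to the
  same history.
\<close>
lemma iterates_measurable_history:
  "z_version t \<in> borel_measurable (history (past t)) \<and> (\<lambda>\<omega>. \<phi> (z_version t \<omega>)) \<in> borel_measurable (history (past t))
   \<and> y_version (t + 1) \<in> borel_measurable (history (past t))"
proof (induction t)
  case 0
  have eq: "z_version 0 \<omega> = z0" "y_version (0 + 1) \<omega> = z0" if "\<omega> \<in> space (history (past 0))" for \<omega>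
    using that z_init y_init by (auto simp: z_version_def y_version_def)
  show ?case
  proof (intro conjI)
    show "z_version 0 \<in> borel_measurable (history (past 0))"
      by (rule measurable_cong[THEN iffD2, OF eq(1) measurable_const]) auto
    show "y_version (0 + 1) \<in> borel_measurable (history (past 0))"
      by (rule measurable_cong[THEN iffD2, OF eq(2) measurable_const]) auto
    show "(\<lambda>\<omega>. \<phi> (z_version 0 \<omega>)) \<in> borel_measurable (history (past 0))"
      by (rule measurable_cong[THEN iffD2, OF arg_cong[where f = \<phi>, OF eq(1)] measurable_const]) auto
  qed
next
  case (Suc t)
  let ?H = "history (past (Suc t))"
  let ?R = "restrict_space ?H {\<omega>. good (Suc t) \<omega>}"
  let ?v = "\<lambda>\<omega>. minibatch G (N (Suc t)) (\<lambda>j. \<xi> (Suc t) j \<omega>) (y_version (Suc t) \<omega>)"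
  have mono: "W \<in> borel_measurable (history (past t)) \<Longrightarrow> W \<in> borel_measurable ?H" for W :: "'w \<Rightarrow> 'a"
    by (rule measurable_history_mono[OF past_mono past_index]) simp_all
  have y_version[measurable]: "y_version (Suc t) \<in> borel_measurable ?H" and zt[measurable]: "z_version t \<in> borel_measurable ?H"
    using Suc by (auto intro: mono)
  have "\<xi> (Suc t) j \<in> measurable ?H P" if "j \<in> {1..N (Suc t)}" for j
    using measurable_history_sample[OF past_index, of "(Suc t, j)" "Suc t"] that by (auto simp: past_def)
  then have "(\<lambda>\<omega>. G (y_version (Suc t) \<omega>) (\<xi> (Suc t) j \<omega>)) \<in> borel_measurable ?H" if "j \<in> {1..N (Suc t)}" for j
    using measurable_compose[OF measurable_Pair[OF y_version, of "\<xi> (Suc t) j" P] G_measurable] that by simp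
  then have v[measurable]: "?v \<in> borel_measurable ?H"
    unfolding minibatch_def by (intro borel_measurable_scaleR borel_measurable_sum) auto
  have arg: "is_arg_min (prox_model f \<phi> (\<alpha> (Suc t)) (y_version (Suc t) \<omega>) (?v \<omega>)) (\<lambda>x. x \<in> X) (z (Suc t) \<omega>)"
    if "\<omega> \<in> space ?R" for \<omega>
  proof -
    have \<omega>: "\<omega> \<in> space M" "good (Suc t) \<omega>" using that by (auto simp: space_restrict_space)
    show ?thesis using z_step[of "Suc t" \<omega>] minibatch_eq_G[of "Suc t" \<omega>] y_version_eq[OF \<omega>(2), of "Suc t"] \<omega> by simp
  qed
  have \<alpha>: "\<alpha> (Suc t) > 0" by (rule \<alpha>_pos) simp
  have zR: "z (Suc t) \<in> borel_measurable ?R" "(\<lambda>\<omega>. \<phi> (z (Suc t) \<omega>)) \<in> borel_measurable ?R"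
    by (rule prox_output_measurable[OF \<phi>_convex \<alpha> measurable_restrict_space1[OF y_version] measurable_restrict_space1[OF v] arg], assumption)+
  have z_version: "z_version (Suc t) \<in> borel_measurable ?H"
    unfolding z_version_def using good_measurable[of "Suc t"] zR(1)
    by (subst measurable_If_restrict_space_iff) auto
  have "(\<lambda>\<omega>. if good (Suc t) \<omega> then \<phi> (z (Suc t) \<omega>) else \<phi> z0) \<in> borel_measurable ?H"
    using good_measurable[of "Suc t"] zR(2)
    by (subst measurable_If_restrict_space_iff) auto
  also have "(\<lambda>\<omega>. if good (Suc t) \<omega> then \<phi> (z (Suc t) \<omega>) else \<phi> z0) = (\<lambda>\<omega>. \<phi> (z_version (Suc t) \<omega>))"
    by (auto simp: z_version_def)
  finally have \<phi>z_version: "(\<lambda>\<omega>. \<phi> (z_version (Suc t) \<omega>)) \<in> borel_measurable ?H" .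
  have "(\<lambda>\<omega>. if good (Suc t) \<omega> then ((\<beta> (Suc t) - 1) / \<beta> (Suc t + 1)) *\<^sub>R (z_version (Suc t) \<omega> - z_version t \<omega>) + z_version (Suc t) \<omega> else z0)
      \<in> borel_measurable ?H"
    using good_measurable[of "Suc t"] z_version zt by measurable
  moreover have "y_version (Suc t + 1) \<omega> = (if good (Suc t) \<omega> then ((\<beta> (Suc t) - 1) / \<beta> (Suc t + 1)) *\<^sub>R (z_version (Suc t) \<omega> - z_version t \<omega>) + z_version (Suc t) \<omega> else z0)"
    if "\<omega> \<in> space M" for \<omega>
    using y_step[of "Suc t" \<omega>] that by (auto simp: y_version_def z_version_eq)
  ultimately have "y_version (Suc t + 1) \<in> borel_measurable ?H"
    by (subst measurable_cong) auto
  with z_version \<phi>z_version show ?case by simp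
qed

lemma z_version_measurable [measurable]: "z_version t \<in> borel_measurable M"
  using iterates_measurable_history measurable_history_imp[OF past_index] by blast

lemma y_version_measurable [measurable]: "1 \<le> t \<Longrightarrow> y_version t \<in> borel_measurable M"
  using iterates_measurable_history[of "t - 1"] measurable_history_imp[OF past_index] by auto

lemma momentum_measurable_history: "momentum z_version t \<in> borel_measurable (history (past t))"
proof -
  have [measurable]: "z_version t \<in> borel_measurable (history (past t))" "z_version (t - 1) \<in> borel_measurable (history (past t))"
    using iterates_measurable_history[of t] iterates_measurable_history[of "t - 1"]
      measurable_history_mono[OF past_mono past_index, of "t - 1" t "z_version (t - 1)" borel] by auto
  show ?thesis unfolding momentum_def by measurable
qed

lemma momentum_measurable [measurable]: "momentum z_version t \<in> borel_measurable M"
  by (rule measurable_history_imp[OF past_index momentum_measurable_history])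

lemma g_z_version_measurable [measurable]: "(\<lambda>\<omega>. g (z_version t \<omega>)) \<in> borel_measurable M"
proof -
  have "continuous_on X f"
    using f_deriv by (meson continuous_on_eq_continuous_within has_derivative_continuous)
  then have "f \<in> borel_measurable (restrict_space borel X)"
    by (rule borel_measurable_continuous_on_restrict)
  moreover have "z_version t \<in> measurable M (restrict_space borel X)"
    using z_version_in_X by (intro measurable_restrict_space2) auto
  ultimately have [measurable]: "(\<lambda>\<omega>. f (z_version t \<omega>)) \<in> borel_measurable M"
    by (rule measurable_compose[rotated])
  have [measurable]: "(\<lambda>\<omega>. \<phi> (z_version t \<omega>)) \<in> borel_measurable M"
    using iterates_measurable_history[of t] measurable_history_imp[OF past_index] by blast
  show ?thesis unfolding g_def by measurable
qed

text \<open>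
  The weight 0 at time 0 lets the Lyapunov function start as the squared distance of
  \<open>z0\<close> to the solution.
\<close>
definition weight :: "nat \<Rightarrow> real"
  where "weight t = (if t = 0 then 0 else 2 * \<alpha> t * (\<beta> t)\<^sup>2)"

definition gap :: "'a \<Rightarrow> nat \<Rightarrow> ennreal"
  where "gap x t = nnexp M (\<lambda>\<omega>. g (z t \<omega>) - g x)"

definition iterate_dist :: "'a \<Rightarrow> nat \<Rightarrow> ennreal"
  where "iterate_dist x t = nnexp M (\<lambda>\<omega>. (norm (z t \<omega> - x))\<^sup>2)"

definition momentum_dist :: "'a \<Rightarrow> nat \<Rightarrow> ennreal"
  where "momentum_dist x t = nnexp M (\<lambda>\<omega>. (norm (momentum z t \<omega> - x))\<^sup>2)"

definition lyapunov :: "'a \<Rightarrow> nat \<Rightarrow> ennreal"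
  where "lyapunov x t = ennreal (weight t) * gap x t + momentum_dist x t"

definition query_var :: "nat \<Rightarrow> ennreal"
  where "query_var t = (\<integral>\<^sup>+ \<omega>. oracle_var (y t \<omega>) \<partial>M)"

lemma gap_z_version: "gap x t = nnexp M (\<lambda>\<omega>. g (z_version t \<omega>) - g x)"
  unfolding gap_def by (rule nn_integral_cong_AE) (use AE_z_version in eventually_elim, auto)

lemma iterate_dist_z_version: "iterate_dist x t = nnexp M (\<lambda>\<omega>. (norm (z_version t \<omega> - x))\<^sup>2)"
  unfolding iterate_dist_def by (rule nn_integral_cong_AE) (use AE_z_version in eventually_elim, auto)

lemma momentum_dist_z_version: "momentum_dist x t = nnexp M (\<lambda>\<omega>. (norm (momentum z_version t \<omega> - x))\<^sup>2)"
  unfolding momentum_dist_def by (rule nn_integral_cong_AE) (use AE_z_version in eventually_elim, auto)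

lemma query_var_y_version: "query_var t = (\<integral>\<^sup>+ \<omega>. oracle_var (y_version t \<omega>) \<partial>M)"
  unfolding query_var_def by (rule nn_integral_cong_AE) (use AE_z_version in eventually_elim, auto)

lemma weight_nonneg: "weight t \<ge> 0"
  using \<alpha>_pos[of t] by (cases "t = 0") (auto simp: weight_def less_imp_le)

text \<open>
  The recursion \<open>\<beta> (t + 1)\<^sup>2 - \<beta> (t + 1) \<le> (\<beta>
  t)\<^sup>2\<close> is what lets the old function gap of step \<open>t + 1\<close> be paid by
  the Lyapunov function at time \<open>t\<close>. At \<open>t = 0\<close> it reads \<open>1 - 1
  \<le> 0\<close>.
\<close>
lemma weight_step: "2 * \<alpha> (t + 1) * ((\<beta> (t + 1))\<^sup>2 - \<beta> (t + 1)) \<le> weight t"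
proof (cases "t = 0")
  case False
  have "\<alpha> (t + 1) * ((\<beta> (t + 1))\<^sup>2 - \<beta> (t + 1)) \<le> \<alpha> t * (\<beta> t)\<^sup>2"
    using False \<alpha>_decreasing[of t] \<beta>_rec[of t] \<beta>_ge_1[of "t + 1"] \<alpha>_pos[of "t + 1"] \<alpha>_pos[of t]
    by (intro mult_mono) (auto simp: power2_eq_square)
  then show ?thesis using False by (simp add: weight_def)
qed (simp add: weight_def \<beta>_1[simplified])

text \<open>
  The extrapolation defining \<open>y\<close> is designed for this identity: the momentum point
  after step \<open>t\<close> is at the same time the combination of the next query point and
  the current iterate that appears in the one-step inequality.
\<close>
lemma momentum_query:
  assumes "\<omega> \<in> space M"
  shows "momentum z t \<omega> = \<beta> (t + 1) *\<^sub>R y (t + 1) \<omega> - (\<beta> (t + 1) - 1) *\<^sub>R z t \<omega>"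
proof (cases "t = 0")
  case True
  then show ?thesis using assms y_init z_init by (simp add: momentum_def algebra_simps)
next
  case False
  have "\<beta> (t + 1) \<noteq> 0" using \<beta>_ge_1[of "t + 1"] by simp
  then have "\<beta> (t + 1) *\<^sub>R y (t + 1) \<omega> = (\<beta> t - 1) *\<^sub>R (z t \<omega> - z (t - 1) \<omega>) + \<beta> (t + 1) *\<^sub>R z t \<omega>"
    using y_step[of t \<omega>] False assms by (simp add: scaleR_right_distrib)
  then show ?thesis using False by (simp add: momentum_def algebra_simps)
qed

abbreviation step_const :: "nat \<Rightarrow> real"
  where "step_const t \<equiv> (\<alpha> t)\<^sup>2 * (\<beta> t)\<^sup>2 / (1 - L * \<alpha> t)"

lemma lyapunov_pathwise:
  assumes x: "x \<in> X" "\<And>u. u \<in> X \<Longrightarrow> g x \<le> g u" and \<omega>: "\<omega> \<in> space M" "good (t + 1) \<omega>"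
  defines "E \<equiv> batch_noise (batch (t + 1)) (y_version (t + 1)) \<omega>"
  shows "weight (t + 1) * (g (z_version (t + 1) \<omega>) - g x) + (norm (momentum z_version (t + 1) \<omega> - x))\<^sup>2
    \<le> weight t * (g (z_version t \<omega>) - g x) + (norm (momentum z_version t \<omega> - x))\<^sup>2
      + step_const (t + 1) * (norm E)\<^sup>2
      - 2 * \<alpha> (t + 1) * \<beta> (t + 1) * inner E (momentum z_version t \<omega> - x)"
proof -
  let ?v = "minibatch gradF (N (t + 1)) (\<lambda>j. \<xi> (t + 1) j \<omega>) (y (t + 1) \<omega>)"
  have good_t: "good t \<omega>" using good_mono[OF _ \<omega>(2), of t] by simp
  have y_eq: "y_version (t + 1) \<omega> = y (t + 1) \<omega>" by (rule y_version_eq[OF \<omega>(2)]) simp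
  have "E = minibatch G (N (t + 1)) (\<lambda>j. \<xi> (t + 1) j \<omega>) (y_version (t + 1) \<omega>) - mean (y_version (t + 1) \<omega>)"
    unfolding E_def using N_pos[of "t + 1"]
    by (subst batch_noise_eq) (auto simp: batch_def minibatch_def sum.reindex inj_on_def card_image)
  also have "\<dots> = ?v - gradf (y (t + 1) \<omega>)"
    using minibatch_eq_G[of "t + 1" \<omega>] \<omega> G_mean[OF y_in_X[of "t + 1" \<omega>]] y_eq by (simp add: mean_def)
  finally have E: "E = ?v - gradf (y (t + 1) \<omega>)" .
  have "2 * \<alpha> (t + 1) * (\<beta> (t + 1))\<^sup>2 * (g (z (t + 1) \<omega>) - g x) + (norm (momentum z (t + 1) \<omega> - x))\<^sup>2
    \<le> 2 * \<alpha> (t + 1) * ((\<beta> (t + 1))\<^sup>2 - \<beta> (t + 1)) * (g (z t \<omega>) - g x) + (norm (momentum z t \<omega> - x))\<^sup>2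
      + step_const (t + 1) * (norm (?v - gradf (y (t + 1) \<omega>)))\<^sup>2
      - 2 * \<alpha> (t + 1) * \<beta> (t + 1) * inner (?v - gradf (y (t + 1) \<omega>)) (momentum z t \<omega> - x)"
    by (rule accelerated_prox_step[OF f_convex f_deriv f_smooth \<phi>_convex \<alpha>_pos \<alpha>_less \<beta>_ge_1 y_in_X z_in_X x(1) z_step])
      (use \<omega> momentum_query in \<open>auto simp: momentum_def g_def\<close>)
  moreover have "2 * \<alpha> (t + 1) * ((\<beta> (t + 1))\<^sup>2 - \<beta> (t + 1)) * (g (z t \<omega>) - g x) \<le> weight t * (g (z t \<omega>) - g x)"
    by (rule mult_right_mono[OF weight_step]) (use x(2) z_in_X \<omega> in auto)
  ultimately show ?thesis
    unfolding E momentum_eq[OF \<omega>(2)] momentum_eq[OF good_t]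
    using z_version_eq[OF \<omega>(2), of t] z_version_eq[OF \<omega>(2), of "t + 1"] by (simp add: weight_def)
qed

lemma lyapunov_nn_integral:
  assumes x: "x \<in> X" "\<And>u. u \<in> X \<Longrightarrow> g x \<le> g u"
  shows "lyapunov x t = nnexp M (\<lambda>\<omega>. weight t * (g (z_version t \<omega>) - g x) + (norm (momentum z_version t \<omega> - x))\<^sup>2)"
proof -
  have "nnexp M (\<lambda>\<omega>. weight t * (g (z_version t \<omega>) - g x) + (norm (momentum z_version t \<omega> - x))\<^sup>2)
      = (\<integral>\<^sup>+ \<omega>. ennreal (weight t) * ennreal (g (z_version t \<omega>) - g x) + ennreal ((norm (momentum z_version t \<omega> - x))\<^sup>2) \<partial>M)"
    using x(2) z_version_in_X weight_nonneg
    by (intro nn_integral_cong) (simp add: ennreal_plus ennreal_mult)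
  also have "\<dots> = lyapunov x t"
    unfolding lyapunov_def gap_z_version momentum_dist_z_version
    by (subst nn_integral_add) (auto simp: nn_integral_cmult)
  finally show ?thesis by simp
qed

text \<open>
  The inner product in the pathwise inequality pairs the batch error with \<open>momentum
  z_version t \<omega> - x\<close>, which is determined by the earlier samples, so it integrates
  to zero, and the squared error contributes the variance divided by the batch size.
\<close>
lemma lyapunov_step:
  assumes x: "x \<in> X" "\<And>u. u \<in> X \<Longrightarrow> g x \<le> g u"
    and fin: "lyapunov x t < \<infinity>" "query_var (t + 1) < \<infinity>"
  shows "lyapunov x (t + 1) \<le> lyapunov x t + ennreal (step_const (t + 1) / real (N (t + 1))) * query_var (t + 1)"
proof -
  let ?J = "batch (t + 1)" and ?A = "past t" and ?Y = "y_version (t + 1)"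
  define U where "U t \<omega> = weight t * (g (z_version t \<omega>) - g x) + (norm (momentum z_version t \<omega> - x))\<^sup>2" for t \<omega>
  have U_meas [measurable]: "U t \<in> borel_measurable M" for t
    unfolding U_def by measurable
  have U_nonneg: "U t \<omega> \<ge> 0" if "\<omega> \<in> space M" for t \<omega>
    unfolding U_def using weight_nonneg x(2)[OF z_version_in_X[OF that]] by simp
  have lyap: "lyapunov x t = nnexp M (U t)" for t
    unfolding U_def by (rule lyapunov_nn_integral[OF x])
  have U_int: "integrable M (U t)"
    by (rule integrableI_bounded) (use fin(1) U_nonneg in \<open>auto simp: lyap cong: nn_integral_cong\<close>)
  define S where "S \<omega> = momentum z_version t \<omega> - x" for \<omega>
  have S_hist: "S \<in> borel_measurable (history ?A)"
    unfolding S_def using momentum_measurable_history by measurable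
  have S_meas[measurable]: "S \<in> borel_measurable M"
    by (rule measurable_history_imp[OF past_index S_hist])
  have S_int: "integrable M (\<lambda>\<omega>. (norm (S \<omega>))\<^sup>2)"
  proof (rule Bochner_Integration.integrable_bound[OF U_int])
    show "AE \<omega> in M. norm ((norm (S \<omega>))\<^sup>2) \<le> norm (U t \<omega>)"
    proof (rule AE_I2)
      fix \<omega> assume "\<omega> \<in> space M"
      then have "0 \<le> weight t * (g (z_version t \<omega>) - g x)"
        using weight_nonneg x(2)[OF z_version_in_X] by simp
      then show "norm ((norm (S \<omega>))\<^sup>2) \<le> norm (U t \<omega>)" by (simp add: U_def S_def)
    qed
  qed simp
  have Y_hist: "?Y \<in> borel_measurable (history ?A)"
    using iterates_measurable_history[of t] by simp
  have qv: "(\<integral>\<^sup>+ \<omega>. oracle_var (?Y \<omega>) \<partial>M) < \<infinity>"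
    using fin(2) by (simp add: query_var_y_version)
  have J: "?J \<subseteq> index" "?A \<inter> ?J = {}" "finite ?J" "?J \<noteq> {}"
    using N_pos[of "t + 1"] by (auto simp: batch_def past_def)
  have card_J: "card ?J = N (t + 1)"
    by (simp add: batch_def card_image inj_on_def)
  define E where "E = batch_noise ?J ?Y"
  note moments = batch_noise_moments[OF past_index J Y_hist S_hist qv S_int, folded E_def query_var_y_version, unfolded card_J]
  define R where "R \<omega> = U t \<omega> + step_const (t + 1) * (norm (E \<omega>))\<^sup>2 - 2 * \<alpha> (t + 1) * \<beta> (t + 1) * inner (E \<omega>) (S \<omega>)" for \<omega>
  have R_int: "integrable M R"
    unfolding R_def using U_int moments(1,3) by simp
  have UR: "AE \<omega> in M. U (t + 1) \<omega> \<le> R \<omega>"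
    using AE_good AE_space
  proof eventually_elim
    case (elim \<omega>)
    then show ?case
      using lyapunov_pathwise[OF x elim(2), of t] by (simp add: U_def R_def S_def E_def)
  qed
  have R_nonneg: "AE \<omega> in M. 0 \<le> R \<omega>"
    using UR AE_space by eventually_elim (use U_nonneg order_trans in blast)
  have "lyapunov x (t + 1) \<le> nnexp M R"
    unfolding lyap by (rule nn_integral_mono_AE) (use UR in eventually_elim, auto intro: ennreal_leI)
  also have "\<dots> = ennreal (LINT \<omega>|M. R \<omega>)"
    by (rule nn_integral_eq_integral[OF R_int R_nonneg])
  also have "(LINT \<omega>|M. R \<omega>) = (LINT \<omega>|M. U t \<omega>) + step_const (t + 1) * (enn2real (query_var (t + 1)) / real (N (t + 1)))"
    unfolding R_def using U_int moments by simp
  also have "ennreal \<dots> = ennreal (LINT \<omega>|M. U t \<omega>) + ennreal (step_const (t + 1) / real (N (t + 1)) * enn2real (query_var (t + 1)))"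
    using \<alpha>_less[of "t + 1"] U_nonneg
    by (subst ennreal_plus[symmetric]) (auto intro!: integral_nonneg_AE)
  also have "ennreal (LINT \<omega>|M. U t \<omega>) = lyapunov x t"
    unfolding lyap by (rule nn_integral_eq_integral[symmetric, OF U_int]) (use U_nonneg in auto)
  also have "ennreal (step_const (t + 1) / real (N (t + 1)) * enn2real (query_var (t + 1)))
      = ennreal (step_const (t + 1) / real (N (t + 1))) * query_var (t + 1)"
    using \<alpha>_less[of "t + 1"] fin(2) by (subst ennreal_mult) (auto simp: less_top)
  finally show ?thesis .
qed

text \<open>
  The iterate is the convex combination of the momentum point and the previous iterate with
  weights \<open>1 / \<beta>\<close> and \<open>1 - 1 / \<beta>\<close>.
\<close>
lemma iterate_dist_step:
  "iterate_dist x (t + 1) \<le> ennreal (1 / \<beta> (t + 1)) * momentum_dist x (t + 1) + ennreal (1 - 1 / \<beta> (t + 1)) * iterate_dist x t"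
proof -
  define q where "q = 1 / \<beta> (t + 1)"
  have q: "0 \<le> q" "q \<le> 1" "\<beta> (t + 1) \<noteq> 0" using \<beta>_ge_1[of "t + 1"] by (auto simp: q_def)
  have conv: "(norm ((1 - r) *\<^sub>R v + r *\<^sub>R u))\<^sup>2 \<le> (1 - r) * (norm v)\<^sup>2 + r * (norm u)\<^sup>2" if "0 \<le> r" "r \<le> 1" for r and u v :: 'a
  proof -
    have "(1 - r) * (norm v)\<^sup>2 + r * (norm u)\<^sup>2 - (norm ((1 - r) *\<^sub>R v + r *\<^sub>R u))\<^sup>2 = r * (1 - r) * (norm (u - v))\<^sup>2"
      unfolding power2_norm_eq_inner inner_add_left inner_add_right inner_diff_left inner_diff_right
        inner_scaleR_left inner_scaleR_right inner_commute[of v u] by algebra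
    moreover have "0 \<le> r * (1 - r) * (norm (u - v))\<^sup>2" using that by simp
    ultimately show ?thesis by linarith
  qed
  have "(norm (z_version (t + 1) \<omega> - x))\<^sup>2 \<le> (1 - q) * (norm (z_version t \<omega> - x))\<^sup>2 + q * (norm (momentum z_version (t + 1) \<omega> - x))\<^sup>2" for \<omega>
  proof -
    have "z_version (t + 1) \<omega> - x = (1 - q) *\<^sub>R (z_version t \<omega> - x) + q *\<^sub>R (momentum z_version (t + 1) \<omega> - x)"
      using q(3) by (simp add: q_def momentum_def scaleR_right_diff_distrib scaleR_left_diff_distrib diff_divide_distrib)
    then show ?thesis using conv[OF q(1,2)] by simp
  qed
  then have "iterate_dist x (t + 1) \<le> nnexp M (\<lambda>\<omega>. (1 - q) * (norm (z_version t \<omega> - x))\<^sup>2 + q * (norm (momentum z_version (t + 1) \<omega> - x))\<^sup>2)"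
    unfolding iterate_dist_z_version by (intro nn_integral_mono ennreal_leI)
  also have "\<dots> = (\<integral>\<^sup>+ \<omega>. ennreal (1 - q) * ennreal ((norm (z_version t \<omega> - x))\<^sup>2) + ennreal q * ennreal ((norm (momentum z_version (t + 1) \<omega> - x))\<^sup>2) \<partial>M)"
    using q by (intro nn_integral_cong) (simp add: ennreal_plus ennreal_mult)
  also have "\<dots> = ennreal (1 - q) * iterate_dist x t + ennreal q * momentum_dist x (t + 1)"
    unfolding iterate_dist_z_version momentum_dist_z_version by (subst nn_integral_add) (auto simp: nn_integral_cmult)
  finally show ?thesis by (simp add: q_def add.commute)
qed

text \<open>
  With \<open>c\<close> the extrapolation coefficient, the query point is \<open>(1 + c)
  z\<^sub>t - c z\<^sub>t\<^sub>-\<^sub>1\<close>; the square of the three-term sum costs a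
  factor 3.
\<close>
lemma query_var_bound:
  assumes var: "\<And>u. u \<in> X \<Longrightarrow> oracle_var u \<le> ennreal ((r + k * norm (u - x))\<^sup>2)"
    and rk: "r \<ge> 0" "k \<ge> 0" and t: "t \<ge> 1"
  defines "c \<equiv> (\<beta> t - 1) / \<beta> (t + 1)"
  shows "query_var (t + 1) \<le> ennreal (3 * r\<^sup>2) + ennreal (3 * (1 + c)\<^sup>2 * k\<^sup>2) * iterate_dist x t
            + ennreal (3 * c\<^sup>2 * k\<^sup>2) * iterate_dist x (t - 1)"
proof -
  have c0: "c \<ge> 0" unfolding c_def using \<beta>_ge_1[of t] \<beta>_ge_1[of "t + 1"] t by simp
  have "oracle_var (y_version (t + 1) \<omega>) \<le> ennreal (3 * r\<^sup>2) + ennreal (3 * (1 + c)\<^sup>2 * k\<^sup>2) * ennreal ((norm (z_version t \<omega> - x))\<^sup>2)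
            + ennreal (3 * c\<^sup>2 * k\<^sup>2) * ennreal ((norm (z_version (t - 1) \<omega> - x))\<^sup>2)" if \<omega>: "\<omega> \<in> space M" "good t \<omega>" for \<omega>
  proof -
    let ?a = "norm (z_version t \<omega> - x)" and ?b = "norm (z_version (t - 1) \<omega> - x)"
    have y: "y_version (t + 1) \<omega> - x = (1 + c) *\<^sub>R (z_version t \<omega> - x) - c *\<^sub>R (z_version (t - 1) \<omega> - x)"
    proof -
      have "y_version (t + 1) \<omega> = y (t + 1) \<omega>" "z_version t \<omega> = z t \<omega>" "z_version (t - 1) \<omega> = z (t - 1) \<omega>"
        using y_version_eq[OF \<omega>(2), of "t + 1"] z_version_eq[OF \<omega>(2)] by simp_all
      moreover have "y (t + 1) \<omega> = c *\<^sub>R (z t \<omega> - z (t - 1) \<omega>) + z t \<omega>"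
        using y_step[OF t \<omega>(1)] by (simp only: c_def)
      moreover have "c *\<^sub>R (u - w) + u - x = (1 + c) *\<^sub>R (u - x) - c *\<^sub>R (w - x)" for u w :: 'a
        by (simp add: algebra_simps)
      ultimately show ?thesis by (simp only:)
    qed
    have "norm (y_version (t + 1) \<omega> - x) \<le> (1 + c) * ?a + c * ?b"
      unfolding y using norm_triangle_ineq4[of "(1 + c) *\<^sub>R (z_version t \<omega> - x)" "c *\<^sub>R (z_version (t - 1) \<omega> - x)"] c0 by simp
    then have "r + k * norm (y_version (t + 1) \<omega> - x) \<le> r + k * ((1 + c) * ?a + c * ?b)"
      using rk by (intro add_left_mono mult_left_mono) auto
    then have "(r + k * norm (y_version (t + 1) \<omega> - x))\<^sup>2 \<le> (r + k * ((1 + c) * ?a + c * ?b))\<^sup>2"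
      using rk by (intro power_mono) auto
    also have "\<dots> = (r + k * (1 + c) * ?a + k * c * ?b)\<^sup>2" by (simp add: algebra_simps)
    also have "\<dots> \<le> 3 * r\<^sup>2 + 3 * (k * (1 + c) * ?a)\<^sup>2 + 3 * (k * c * ?b)\<^sup>2"
    proof -
      have "(p + q + s)\<^sup>2 \<le> 3 * p\<^sup>2 + 3 * q\<^sup>2 + 3 * s\<^sup>2" for p q s :: real
      proof -
        have "3 * p\<^sup>2 + 3 * q\<^sup>2 + 3 * s\<^sup>2 - (p + q + s)\<^sup>2 = (p - q)\<^sup>2 + (q - s)\<^sup>2 + (p - s)\<^sup>2"
          by algebra
        moreover have "0 \<le> (p - q)\<^sup>2 + (q - s)\<^sup>2 + (p - s)\<^sup>2" by simp
        ultimately show ?thesis by linarith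
      qed
      then show ?thesis .
    qed
    also have "\<dots> = 3 * r\<^sup>2 + 3 * (1 + c)\<^sup>2 * k\<^sup>2 * ?a\<^sup>2 + 3 * c\<^sup>2 * k\<^sup>2 * ?b\<^sup>2"
      by (simp add: power_mult_distrib)
    finally have sq: "(r + k * norm (y_version (t + 1) \<omega> - x))\<^sup>2 \<le> 3 * r\<^sup>2 + 3 * (1 + c)\<^sup>2 * k\<^sup>2 * ?a\<^sup>2 + 3 * c\<^sup>2 * k\<^sup>2 * ?b\<^sup>2" .
    have "oracle_var (y_version (t + 1) \<omega>) \<le> ennreal ((r + k * norm (y_version (t + 1) \<omega> - x))\<^sup>2)"
      by (rule var[OF y_version_in_X]) (use \<omega> in auto)
    also note ennreal_leI[OF sq]
    finally have "oracle_var (y_version (t + 1) \<omega>) \<le> ennreal (3 * r\<^sup>2 + 3 * (1 + c)\<^sup>2 * k\<^sup>2 * ?a\<^sup>2 + 3 * c\<^sup>2 * k\<^sup>2 * ?b\<^sup>2)" .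
    then show ?thesis by (simp add: ennreal_plus ennreal_mult)
  qed
  then have "AE \<omega> in M. oracle_var (y_version (t + 1) \<omega>) \<le> ennreal (3 * r\<^sup>2) + ennreal (3 * (1 + c)\<^sup>2 * k\<^sup>2) * ennreal ((norm (z_version t \<omega> - x))\<^sup>2)
            + ennreal (3 * c\<^sup>2 * k\<^sup>2) * ennreal ((norm (z_version (t - 1) \<omega> - x))\<^sup>2)"
    using AE_good AE_space by (auto elim: eventually_elim2)
  from nn_integral_mono_AE[OF this]
  have "query_var (t + 1) \<le> (\<integral>\<^sup>+ \<omega>. ennreal (3 * r\<^sup>2) + ennreal (3 * (1 + c)\<^sup>2 * k\<^sup>2) * ennreal ((norm (z_version t \<omega> - x))\<^sup>2)
            + ennreal (3 * c\<^sup>2 * k\<^sup>2) * ennreal ((norm (z_version (t - 1) \<omega> - x))\<^sup>2) \<partial>M)"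
    unfolding query_var_y_version .
  also have "\<dots> = ennreal (3 * r\<^sup>2) + ennreal (3 * (1 + c)\<^sup>2 * k\<^sup>2) * iterate_dist x t
            + ennreal (3 * c\<^sup>2 * k\<^sup>2) * iterate_dist x (t - 1)"
    unfolding iterate_dist_z_version by (simp add: nn_integral_add nn_integral_cmult emeasure_space_1)
  finally show ?thesis .
qed

text \<open>
  The recursions only say something once their right-hand sides are finite, so finiteness is
  carried by induction from the deterministic starting point.
\<close>
lemma moments_finite:
  assumes x: "x \<in> X" "\<And>u. u \<in> X \<Longrightarrow> g x \<le> g u"
    and var: "\<And>u. u \<in> X \<Longrightarrow> oracle_var u \<le> ennreal ((r + k * norm (u - x))\<^sup>2)"
    and rk: "r \<ge> 0" "k \<ge> 0"
  shows "lyapunov x t < \<infinity>" "iterate_dist x t < \<infinity>" "query_var (t + 1) < \<infinity>"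
proof -
  have dist0: "iterate_dist x 0 < \<infinity>"
  proof -
    have "iterate_dist x 0 = (\<integral>\<^sup>+ \<omega>. ennreal ((norm (z0 - x))\<^sup>2) \<partial>M)"
      unfolding iterate_dist_def by (rule nn_integral_cong) (simp add: z_init)
    then show ?thesis by (simp add: emeasure_space_1)
  qed
  have query: "query_var (t + 1) < \<infinity>" if "iterate_dist x t < \<infinity>" "iterate_dist x (t - 1) < \<infinity>" for t
  proof (cases "t = 0")
    case True
    have "query_var 1 \<le> (\<integral>\<^sup>+ \<omega>. ennreal ((r + k * norm (z0 - x))\<^sup>2) \<partial>M)"
      unfolding query_var_def by (rule nn_integral_mono) (use var[OF z0] y_init in auto)
    also have "\<dots> < \<infinity>" by (simp add: emeasure_space_1)
    finally show ?thesis using True by simp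
  next
    case False
    then have "t \<ge> 1" by simp
    from query_var_bound[OF var rk this] that show ?thesis
      by (auto simp: ennreal_mult_less_top elim!: order_le_less_trans)
  qed
  have "lyapunov x t < \<infinity> \<and> iterate_dist x t < \<infinity> \<and> iterate_dist x (t - 1) < \<infinity>" for t
  proof (induction t)
    case 0
    have "gap x 0 = (\<integral>\<^sup>+ \<omega>. ennreal (g z0 - g x) \<partial>M)"
      unfolding gap_def by (rule nn_integral_cong) (simp add: z_init)
    then have "gap x 0 < \<infinity>" by (simp add: emeasure_space_1)
    moreover have "momentum_dist x 0 < \<infinity>"
      unfolding momentum_dist_def momentum_def by (simp add: emeasure_space_1)
    ultimately show ?case using dist0 by (simp add: lyapunov_def weight_def)
  next
    case (Suc t)
    have q: "query_var (t + 1) < \<infinity>" using Suc query by blast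
    have l: "lyapunov x (t + 1) < \<infinity>"
      by (rule order_le_less_trans[OF lyapunov_step[OF x _ q]])
        (use Suc q in \<open>auto simp: ennreal_mult_less_top\<close>)
    then have m: "momentum_dist x (t + 1) < \<infinity>" by (simp add: lyapunov_def)
    have "iterate_dist x (t + 1) < \<infinity>"
      by (rule order_le_less_trans[OF iterate_dist_step]) (use Suc m in \<open>auto simp: ennreal_mult_less_top\<close>)
    then show ?case using l Suc by simp
  qed
  then show "lyapunov x t < \<infinity>" "iterate_dist x t < \<infinity>" "query_var (t + 1) < \<infinity>" using query by blast+
qed

text \<open>
  The extended-real recursions in real numbers. Since \<open>c \<le> 1\<close>, the coefficients
  \<open>3 (1 + c)\<^sup>2\<close> and \<open>3 c\<^sup>2\<close> are at most 12 and 3, which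
  add up to the 15 of the theorem. At \<open>t = 1\<close> there is no extrapolation, so the
  distance of the starting point never enters.
\<close>
lemma moments_real:
  assumes x: "x \<in> X" "\<And>u. u \<in> X \<Longrightarrow> g x \<le> g u"
    and var: "\<And>u. u \<in> X \<Longrightarrow> oracle_var u \<le> ennreal ((r + k * norm (u - x))\<^sup>2)"
    and rk: "r \<ge> 0" "k \<ge> 0"
  obtains V D :: "nat \<Rightarrow> real"
  where "\<And>t. lyapunov x t = ennreal (V t)" "\<And>t. iterate_dist x t = ennreal (D t)"
    "\<And>t. V t \<ge> 0" "\<And>t. D t \<ge> 0"
    "\<And>t. D (t + 1) \<le> (1 / \<beta> (t + 1)) * V (t + 1) + (1 - 1 / \<beta> (t + 1)) * D t"
    "\<And>t. t \<ge> 1 \<Longrightarrow> \<beta> t - 1 \<le> \<beta> (t + 1) \<Longrightarrow> V (t + 1) \<le> V t + step_const (t + 1) / real (N (t + 1))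
        * (3 * r\<^sup>2 + 4 * (3 * k\<^sup>2) * D t + (if t = 1 then 0 else 3 * k\<^sup>2 * D (t - 1)))"
proof -
  define V where "V t = enn2real (lyapunov x t)" for t
  define D where "D t = enn2real (iterate_dist x t)" for t
  note fin = moments_finite[OF x var rk]
  have V: "lyapunov x t = ennreal (V t)" and D: "iterate_dist x t = ennreal (D t)"
    and V0: "V t \<ge> 0" and D0: "D t \<ge> 0" for t
    using fin[of t] by (auto simp: V_def D_def)
  have D_step: "D (t + 1) \<le> (1 / \<beta> (t + 1)) * V (t + 1) + (1 - 1 / \<beta> (t + 1)) * D t" for t
  proof -
    define q where "q = 1 / \<beta> (t + 1)"
    have q: "0 \<le> q" "q \<le> 1" using \<beta>_ge_1[of "t + 1"] by (auto simp: q_def)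
    have "ennreal (D (t + 1)) \<le> ennreal q * momentum_dist x (t + 1) + ennreal (1 - q) * ennreal (D t)"
      using iterate_dist_step[of x t] by (simp only: q_def D)
    also have "\<dots> \<le> ennreal q * ennreal (V (t + 1)) + ennreal (1 - q) * ennreal (D t)"
      by (intro add_mono mult_left_mono) (auto simp: V[symmetric] lyapunov_def)
    also have "\<dots> = ennreal (q * V (t + 1) + (1 - q) * D t)"
      using q V0 D0 by (simp add: ennreal_plus ennreal_mult)
    finally have "D (t + 1) \<le> q * V (t + 1) + (1 - q) * D t"
      using q V0[of "t + 1"] D0[of t] by (subst (asm) ennreal_le_iff) auto
    then show ?thesis by (simp only: q_def)
  qed
  have V_step: "V (t + 1) \<le> V t + step_const (t + 1) / real (N (t + 1))
        * (3 * r\<^sup>2 + 4 * (3 * k\<^sup>2) * D t + (if t = 1 then 0 else 3 * k\<^sup>2 * D (t - 1)))"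
    if t: "t \<ge> 1" and mono: "\<beta> t - 1 \<le> \<beta> (t + 1)" for t
  proof -
    define c where "c = (\<beta> t - 1) / \<beta> (t + 1)"
    define h where "h = step_const (t + 1) / real (N (t + 1))"
    have h: "h \<ge> 0" using \<alpha>_less[of "t + 1"] by (simp add: h_def)
    have c: "0 \<le> c" "c \<le> 1" using mono \<beta>_ge_1[of t] \<beta>_ge_1[of "t + 1"] t by (auto simp: c_def)
    let ?B = "3 * r\<^sup>2 + 3 * (1 + c)\<^sup>2 * k\<^sup>2 * D t + 3 * c\<^sup>2 * k\<^sup>2 * D (t - 1)"
    have "query_var (t + 1) \<le> ennreal (3 * r\<^sup>2) + ennreal (3 * (1 + c)\<^sup>2 * k\<^sup>2) * ennreal (D t) + ennreal (3 * c\<^sup>2 * k\<^sup>2) * ennreal (D (t - 1))"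
      using query_var_bound[OF var rk t] by (simp only: c_def D)
    also have "\<dots> = ennreal ?B" using D0 by (simp add: ennreal_plus ennreal_mult)
    finally have q: "query_var (t + 1) \<le> ennreal ?B" .
    have "ennreal (V (t + 1)) \<le> ennreal (V t) + ennreal h * query_var (t + 1)"
      using lyapunov_step[OF x fin(1,3), of t] by (simp only: V h_def)
    also have "\<dots> \<le> ennreal (V t) + ennreal h * ennreal ?B"
      by (intro add_left_mono mult_left_mono q) simp
    also have "\<dots> = ennreal (V t + h * ?B)"
      using V0 D0 h by (simp add: ennreal_plus ennreal_mult)
    finally have *: "V (t + 1) \<le> V t + h * ?B"
      using h V0 D0 by (subst (asm) ennreal_le_iff) auto
    have "(1 + c)\<^sup>2 \<le> 2\<^sup>2" "c\<^sup>2 \<le> 1\<^sup>2" using c by (intro power_mono; simp)+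
    then have "3 * k\<^sup>2 * D t * (1 + c)\<^sup>2 \<le> 3 * k\<^sup>2 * D t * 4" "3 * k\<^sup>2 * D (t - 1) * c\<^sup>2 \<le> 3 * k\<^sup>2 * D (t - 1) * 1"
      using D0 by (intro mult_left_mono; simp)+
    moreover have "c = 0" if "t = 1" using that \<beta>_1 by (simp add: c_def)
    ultimately have "?B \<le> 3 * r\<^sup>2 + 4 * (3 * k\<^sup>2) * D t + (if t = 1 then 0 else 3 * k\<^sup>2 * D (t - 1))"
      by (auto simp: algebra_simps)
    from mult_left_mono[OF this h] * show ?thesis unfolding h_def by linarith
  qed
  show ?thesis by (rule that[OF V D V0 D0 D_step V_step])
qed

lemma gap_finite:
  assumes "x \<in> X" "\<And>u. u \<in> X \<Longrightarrow> g x \<le> g u"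
    and "\<And>u. u \<in> X \<Longrightarrow> oracle_var u \<le> ennreal ((r + k * norm (u - x))\<^sup>2)"
    and "r \<ge> 0" "k \<ge> 0" and t: "t \<ge> 1"
  shows "gap x t < \<infinity>" "momentum_dist x t < \<infinity>"
proof -
  have "weight t > 0" using \<alpha>_pos[OF t] \<beta>_ge_1[OF t] t by (simp add: weight_def)
  then show "gap x t < \<infinity>" "momentum_dist x t < \<infinity>"
    using moments_finite(1)[OF assms(1-5), of t] unfolding lyapunov_def
    by (auto simp: ennreal_mult_less_top)
qed

lemma iterate_dist_bound:
  assumes x: "x \<in> X" "\<And>u. u \<in> X \<Longrightarrow> g x \<le> g u"
    and var: "\<And>u. u \<in> X \<Longrightarrow> oracle_var u \<le> ennreal ((r + k * norm (u - x))\<^sup>2)"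
    and r: "r \<ge> 0" and k: "k > 0"
    and growth: "\<And>t. 1 \<le> t \<Longrightarrow> \<beta> t - 1 \<le> \<beta> (t + 1)"
    and p: "p \<ge> 1" and \<gamma>: "\<And>q. (\<Sum>t = p..<q. step_const (t + 1) / real (N (t + 1))) \<le> \<gamma>" "\<gamma> < 1 / (15 * k\<^sup>2)"
    and t: "t \<ge> 1"
  shows "iterate_dist x t \<le> ((MAX \<tau>\<in>{1..p}. lyapunov x \<tau>) + ennreal (r\<^sup>2) / ennreal (3 * k\<^sup>2)) / ennreal (1 - 15 * \<gamma> * k\<^sup>2)"
proof -
  obtain V D where VD: "\<And>t. lyapunov x t = ennreal (V t)" "\<And>t. iterate_dist x t = ennreal (D t)"
    "\<And>t. V t \<ge> 0" "\<And>t. D t \<ge> 0"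
    "\<And>t. D (t + 1) \<le> (1 / \<beta> (t + 1)) * V (t + 1) + (1 - 1 / \<beta> (t + 1)) * D t"
    "\<And>t. t \<ge> 1 \<Longrightarrow> \<beta> t - 1 \<le> \<beta> (t + 1) \<Longrightarrow> V (t + 1) \<le> V t + step_const (t + 1) / real (N (t + 1))
        * (3 * r\<^sup>2 + 4 * (3 * k\<^sup>2) * D t + (if t = 1 then 0 else 3 * k\<^sup>2 * D (t - 1)))"
    using moments_real[OF x var r less_imp_le[OF k]] by blast
  define C where "C = (MAX \<tau>\<in>{1..p}. V \<tau>)"
  have C: "V \<tau> \<le> C" if "1 \<le> \<tau>" "\<tau> \<le> p" for \<tau>
    unfolding C_def using that by (intro Max_ge) auto
  have "C \<in> V ` {1..p}" unfolding C_def using p by (intro Max_in) auto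
  then obtain \<tau> where \<tau>: "\<tau> \<in> {1..p}" "C = V \<tau>" by auto
  have C0: "C \<ge> 0" using \<tau> VD(3) by simp
  have "ennreal C \<le> (MAX \<tau>\<in>{1..p}. lyapunov x \<tau>)"
    unfolding \<tau>(2) VD(1)[symmetric] using \<tau>(1) by (intro Max_ge) auto
  have \<gamma>0: "\<gamma> \<ge> 0" using \<gamma>(1)[of p] by simp
  have \<gamma>k: "15 * \<gamma> * k\<^sup>2 < 1" using \<gamma>(2) k by (simp add: field_simps)
  define q where "q = 1 - 15 * \<gamma> * k\<^sup>2"
  have q: "q > 0" using \<gamma>k by (simp add: q_def)
  define e where "e = r\<^sup>2 / (3 * k\<^sup>2)"
  have e: "e \<ge> 0" "ennreal e = ennreal (r\<^sup>2) / ennreal (3 * k\<^sup>2)"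
    using k by (simp_all add: e_def divide_ennreal)
  have eq: "5 * (3 * k\<^sup>2) * \<gamma> = 15 * \<gamma> * k\<^sup>2" by simp
  have "D t \<le> (C + \<gamma> * (3 * r\<^sup>2)) / (1 - 5 * (3 * k\<^sup>2) * \<gamma>)"
  proof (rule bounded_by_self_consistent_recursion[OF p \<beta>_1 \<beta>_ge_1 VD(6)[OF _ growth] VD(5) VD(4) _ _ _ \<gamma>0 C \<gamma>(1) _ t])
    show "0 \<le> step_const (\<tau> + 1) / real (N (\<tau> + 1))" if "1 \<le> \<tau>" for \<tau>
      using \<alpha>_less[of "\<tau> + 1"] by simp
    show "5 * (3 * k\<^sup>2) * \<gamma> < 1" unfolding eq by (rule \<gamma>k)
    show "0 \<le> 3 * r\<^sup>2" "0 \<le> 3 * k\<^sup>2" by simp_all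
  qed assumption+
  also have "\<dots> = (C + \<gamma> * (3 * r\<^sup>2)) / q" by (simp only: eq q_def)
  also have "\<dots> \<le> (C + e) / q"
  proof -
    \<comment> \<open>This gives \<open>r\<^sup>2 / (5 * k\<^sup>2)\<close>, slightly better than the constant
       in the statement.\<close>
    have "\<gamma> * (3 * r\<^sup>2) \<le> 1 / (15 * k\<^sup>2) * (3 * r\<^sup>2)"
      using \<gamma>(2) by (intro mult_right_mono) auto
    also have "\<dots> = (r\<^sup>2 / k\<^sup>2) * (1 / 5)" by simp
    also have "\<dots> \<le> (r\<^sup>2 / k\<^sup>2) * (1 / 3)" by (rule mult_left_mono) auto
    also have "\<dots> = e" by (simp add: e_def)
    finally show ?thesis using q by (intro divide_right_mono add_left_mono) auto
  qed
  finally have "iterate_dist x t \<le> ennreal ((C + e) / q)"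
    unfolding VD(2) by (rule ennreal_leI)
  also have "\<dots> = ennreal (C + e) / ennreal q"
    using C0 e q by (intro divide_ennreal[symmetric]) auto
  also have "\<dots> = (ennreal C + ennreal (r\<^sup>2) / ennreal (3 * k\<^sup>2)) / ennreal q"
    using C0 e(1) by (simp only: ennreal_plus e(2))
  also have "\<dots> \<le> ((MAX \<tau>\<in>{1..p}. lyapunov x \<tau>) + ennreal (r\<^sup>2) / ennreal (3 * k\<^sup>2)) / ennreal q"
    by (intro divide_right_mono_ennreal add_right_mono) fact
  finally show ?thesis unfolding q_def .
qed

text \<open>
  Summing the Lyapunov recursion from time 1, with all distances replaced by their bound
  \<open>J\<close>.
\<close>
lemma gap_bound:
  assumes x: "x \<in> X" "\<And>u. u \<in> X \<Longrightarrow> g x \<le> g u"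
    and var: "\<And>u. u \<in> X \<Longrightarrow> oracle_var u \<le> ennreal ((r + k * norm (u - x))\<^sup>2)"
    and r: "r \<ge> 0" and k: "k \<ge> 0"
    and growth: "\<And>t. 1 \<le> t \<Longrightarrow> \<beta> t - 1 \<le> \<beta> (t + 1)"
    and J: "\<And>t. t \<ge> 1 \<Longrightarrow> iterate_dist x t \<le> ennreal J" "J \<ge> 0"
    and \<Gamma>: "(\<Sum>\<tau> = 1..<Suc t. step_const (\<tau> + 1) / real (N (\<tau> + 1))) \<le> \<Gamma>"
    and t: "t \<ge> 1"
  shows "ennreal (weight (t + 1)) * gap x (t + 1) \<le> lyapunov x 1 + ennreal (\<Gamma> * (3 * r\<^sup>2 + 15 * k\<^sup>2 * J))"
proof -
  obtain V D where VD: "\<And>t. lyapunov x t = ennreal (V t)" "\<And>t. iterate_dist x t = ennreal (D t)"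
    "\<And>t. V t \<ge> 0" "\<And>t. D t \<ge> 0"
    "\<And>t. D (t + 1) \<le> (1 / \<beta> (t + 1)) * V (t + 1) + (1 - 1 / \<beta> (t + 1)) * D t"
    "\<And>t. t \<ge> 1 \<Longrightarrow> \<beta> t - 1 \<le> \<beta> (t + 1) \<Longrightarrow> V (t + 1) \<le> V t + step_const (t + 1) / real (N (t + 1))
        * (3 * r\<^sup>2 + 4 * (3 * k\<^sup>2) * D t + (if t = 1 then 0 else 3 * k\<^sup>2 * D (t - 1)))"
    using moments_real[OF x var r k] by blast
  have DJ: "D \<tau> \<le> J" if "\<tau> \<ge> 1" for \<tau>
    using J(1)[OF that] J(2) by (simp add: VD(2))
  let ?c = "\<lambda>\<tau>. step_const (\<tau> + 1) / real (N (\<tau> + 1))"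
  let ?K = "3 * r\<^sup>2 + 15 * k\<^sup>2 * J"
  have c0: "?c \<tau> \<ge> 0" for \<tau> using \<alpha>_less[of "\<tau> + 1"] by simp
  have step: "V (Suc \<tau>) \<le> V \<tau> + ?c \<tau> * ?K" if \<tau>: "\<tau> \<ge> 1" for \<tau>
  proof -
    have "(if \<tau> = 1 then 0 else 3 * k\<^sup>2 * D (\<tau> - 1)) \<le> 3 * k\<^sup>2 * J"
      using DJ[of "\<tau> - 1"] \<tau> J(2) by (auto intro!: mult_left_mono)
    moreover have "4 * (3 * k\<^sup>2) * D \<tau> \<le> 4 * (3 * k\<^sup>2) * J"
      using DJ[OF \<tau>] by (intro mult_left_mono) auto
    ultimately have "3 * r\<^sup>2 + 4 * (3 * k\<^sup>2) * D \<tau> + (if \<tau> = 1 then 0 else 3 * k\<^sup>2 * D (\<tau> - 1)) \<le> ?K" by linarith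
    from mult_left_mono[OF this c0[of \<tau>]] VD(6)[OF \<tau> growth[OF \<tau>]] show ?thesis by simp
  qed
  have "V (Suc n) \<le> V 1 + (\<Sum>\<tau> = 1..<Suc n. ?c \<tau>) * ?K" for n
  proof (induction n)
    case (Suc n)
    have "(\<Sum>\<tau> = 1..<Suc (Suc n). ?c \<tau>) = (\<Sum>\<tau> = 1..<Suc n. ?c \<tau>) + ?c (Suc n)"
      by (rule sum.atLeastLessThan_Suc) simp
    then show ?case using step[of "Suc n"] Suc by (simp add: distrib_right)
  qed simp
  also have "(\<Sum>\<tau> = 1..<Suc t. ?c \<tau>) * ?K \<le> \<Gamma> * ?K"
    using \<Gamma> J(2) by (intro mult_right_mono) auto
  finally have "V (t + 1) \<le> V 1 + \<Gamma> * ?K" by simp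
  moreover have "0 \<le> (\<Sum>\<tau> = 1..<Suc t. ?c \<tau>)" by (rule sum_nonneg) (rule c0)
  then have "\<Gamma> \<ge> 0" using \<Gamma> by linarith
  ultimately have \<Gamma>0: "\<Gamma> \<ge> 0" and V: "V (t + 1) \<le> V 1 + \<Gamma> * ?K" by auto
  have "ennreal (weight (t + 1)) * gap x (t + 1) \<le> lyapunov x (t + 1)"
    by (simp add: lyapunov_def)
  also have "\<dots> \<le> ennreal (V 1 + \<Gamma> * ?K)"
    unfolding VD(1) using V by (rule ennreal_leI)
  also have "\<dots> = lyapunov x 1 + ennreal (\<Gamma> * ?K)"
    unfolding VD(1) using VD(3) \<Gamma>0 J(2) by (intro ennreal_plus) auto
  finally show ?thesis .
qed

end

section \<open>Convergence with increasing batch sizes\<close>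

theorem theorem1:
  fixes X :: "'a::euclidean_space set"
    and P :: "'x measure"
    and F :: "'a \<Rightarrow> 'x \<Rightarrow> real"
    and gradF :: "'a \<Rightarrow> 'x \<Rightarrow> 'a"
    and f \<phi> g :: "'a \<Rightarrow> real"
    and gradf :: "'a \<Rightarrow> 'a"
    and \<sigma> :: "'a \<Rightarrow> ennreal"
    and S :: "'a set"
    and L \<sigma>\<^sub>L gstar \<mu> a b \<delta> \<theta> :: real
    and M :: "'w measure"
    and \<xi> :: "nat \<Rightarrow> nat \<Rightarrow> 'w \<Rightarrow> 'x"
    and \<alpha> \<beta> :: "nat \<Rightarrow> real"
    and N :: "nat \<Rightarrow> nat"
    and N0 t0 :: nat
    and z0 :: 'a
    and y z s :: "nat \<Rightarrow> 'w \<Rightarrow> 'a"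
  assumes X: "closed X" "convex X"
    and P: "prob_space P"
    and F_measurable: "(\<lambda>(x, \<zeta>). F x \<zeta>) \<in> borel_measurable (restrict_space borel X \<Otimes>\<^sub>M P)"
    and F_regular: "AE \<zeta> in P. convex_on X (\<lambda>x. F x \<zeta>) \<and>
          (\<forall>x\<in>X. ((\<lambda>x. F x \<zeta>) has_derivative (\<lambda>h. inner (gradF x \<zeta>) h)) (at x within X)) \<and>
          continuous_on X (\<lambda>x. gradF x \<zeta>)"
    and F_integrable: "\<And>x. x \<in> X \<Longrightarrow> integrable P (F x)"
    and gradF_integrable: "\<And>x. x \<in> X \<Longrightarrow> integrable P (gradF x)"
    and f_def: "f = (\<lambda>x. LINT \<zeta>|P. F x \<zeta>)"
    and gradf_def: "gradf = (\<lambda>x. LINT \<zeta>|P. gradF x \<zeta>)"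
    and f_convex: "convex_on X f"
    and f_derivative: "\<And>x. x \<in> X \<Longrightarrow> (f has_derivative (\<lambda>h. inner (gradf x) h)) (at x within X)"
    and L: "L > 0"
    and f_smooth: "\<And>x x'. x \<in> X \<Longrightarrow> x' \<in> X \<Longrightarrow> norm (gradf x - gradf x') \<le> L * norm (x - x')"
    and \<phi>_convex: "convex_on X \<phi>"
    and prox_well_defined: "\<And>\<kappa> x v. \<kappa> > 0 \<Longrightarrow> x \<in> X \<Longrightarrow>
          \<exists>!p. is_arg_min (prox_model f \<phi> \<kappa> x v) (\<lambda>p. p \<in> X) p"
    and g_def: "g = (\<lambda>x. f x + \<phi> x)"
    and gstar_def: "gstar = (INF x\<in>X. g x)"
    and S_def: "S = {x. is_arg_min g (\<lambda>x. x \<in> X) x}"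
    and \<sigma>_def: "\<sigma> = noise_sd P gradF gradf"
    and \<sigma>_finite: "\<exists>x0\<in>X. \<sigma> x0 < \<infinity>"
    and \<sigma>\<^sub>L: "\<sigma>\<^sub>L > 0"
    and \<sigma>_multiplicative: "\<And>x x'. x \<in> X \<Longrightarrow> x' \<in> X \<Longrightarrow>
          \<sigma> x \<le> \<sigma> x' + ennreal (\<sigma>\<^sub>L * norm (x - x'))"
    and M: "prob_space M"
    and sample_indep: "prob_space.indep_vars M (\<lambda>_. P) (\<lambda>(t, j). \<xi> t j)
          {(t, j). 1 \<le> t \<and> 1 \<le> j \<and> j \<le> N t}"
    and sample_distr: "\<And>t j. 1 \<le> t \<Longrightarrow> 1 \<le> j \<Longrightarrow> j \<le> N t \<Longrightarrow> distr M P (\<xi> t j) = P"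
    and initial: "z0 \<in> X" "\<And>\<omega>. \<omega> \<in> space M \<Longrightarrow> z 0 \<omega> = z0"
          "\<And>\<omega>. \<omega> \<in> space M \<Longrightarrow> y 1 \<omega> = z0"
    and y_in_X: "\<And>t \<omega>. 1 \<le> t \<Longrightarrow> \<omega> \<in> space M \<Longrightarrow> y t \<omega> \<in> X"
    and z_step: "\<And>t \<omega>. 1 \<le> t \<Longrightarrow> \<omega> \<in> space M \<Longrightarrow>
          is_arg_min
            (prox_model f \<phi> (\<alpha> t) (y t \<omega>) (minibatch gradF (N t) (\<lambda>j. \<xi> t j \<omega>) (y t \<omega>)))
            (\<lambda>x. x \<in> X) (z t \<omega>)"
    and y_step: "\<And>t \<omega>. 1 \<le> t \<Longrightarrow> \<omega> \<in> space M \<Longrightarrow>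
          y (t + 1) \<omega> = ((\<beta> t - 1) / \<beta> (t + 1)) *\<^sub>R (z t \<omega> - z (t - 1) \<omega>) + z t \<omega>"
    and s_def: "\<And>t \<omega>. 1 \<le> t \<Longrightarrow> \<omega> \<in> space M \<Longrightarrow>
          s t \<omega> = \<beta> t *\<^sub>R z t \<omega> - (\<beta> t - 1) *\<^sub>R z (t - 1) \<omega>"
    and \<alpha>_nonincreasing: "\<And>t. 1 \<le> t \<Longrightarrow> \<alpha> (t + 1) \<le> \<alpha> t"
    and \<alpha>_range: "\<And>t. 1 \<le> t \<Longrightarrow> 0 < \<alpha> t \<and> \<alpha> t < 1 / L"
    and \<beta>_ge_1: "\<And>t. 1 \<le> t \<Longrightarrow> \<beta> t \<ge> 1"
    and \<beta>_recursion: "\<And>t. 1 \<le> t \<Longrightarrow> (\<beta> t)\<^sup>2 \<ge> (\<beta> (t + 1))\<^sup>2 - \<beta> (t + 1)"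
    and parameters: "0 < \<mu>" "\<mu> < 1" "a > 0" "b > 0" "\<delta> > 0" "N0 \<ge> 1"
    and \<beta>_choice: "\<And>t. 1 \<le> t \<Longrightarrow> \<beta> t = (1 + real t) / 2"
    and \<alpha>_choice: "\<And>t. 1 \<le> t \<Longrightarrow> \<alpha> t = \<mu> / (L + a / sqrt (real N0))"
    and N_choice: "\<And>t. 1 \<le> t \<Longrightarrow>
          N t = N0 * nat \<lceil>(real t + 2 + \<delta>) ^ 3 * (ln (real t + 2 + \<delta>)) powr (1 + 2 * b)\<rceil>"
    and \<theta>: "0 < \<theta>" "\<theta> < 1"
    and t0_def: "t0 = burn_in (\<alpha> 1 * \<sigma>\<^sub>L) N0 b \<delta> \<theta>"
  shows "series_term \<alpha> \<beta> N L summable_on {1..} \<and>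
    (\<theta> \<le> 1 - L * \<alpha> 1 \<longrightarrow>
      (\<Sum>\<^sub>\<infinity>t\<in>{t0..}. series_term \<alpha> \<beta> N L t) < 1 / (15 * \<sigma>\<^sub>L\<^sup>2)) \<and>
    (\<forall>x\<in>S.
      (\<forall>t\<ge>1. nnexp M (\<lambda>\<omega>. g (z t \<omega>) - gstar) < \<infinity> \<and>
             nnexp M (\<lambda>\<omega>. (norm (s t \<omega> - x))\<^sup>2) < \<infinity>) \<and>
      (\<forall>\<gamma>>0. (\<Sum>\<^sub>\<infinity>t\<in>{t0..}. series_term \<alpha> \<beta> N L t) < \<gamma> \<and> \<gamma> < 1 / (15 * \<sigma>\<^sub>L\<^sup>2) \<longrightarrow>
        (SUP t\<in>{1..}. nnexp M (\<lambda>\<omega>. (norm (z t \<omega> - x))\<^sup>2)) \<le>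
          ((MAX t\<in>{1..t0}. ennreal (2 * \<alpha> t * (\<beta> t)\<^sup>2) * nnexp M (\<lambda>\<omega>. g (z t \<omega>) - gstar)
                + nnexp M (\<lambda>\<omega>. (norm (s t \<omega> - x))\<^sup>2))
            + (\<sigma> x)\<^sup>2 / ennreal (3 * \<sigma>\<^sub>L\<^sup>2))
          / ennreal (1 - 15 * \<gamma> * \<sigma>\<^sub>L\<^sup>2)) \<and>
      (\<forall>J>0. (SUP \<tau>\<in>{1..}. nnexp M (\<lambda>\<omega>. (norm (z \<tau> \<omega> - x))\<^sup>2)) \<le> ennreal J \<longrightarrow>
        (\<forall>t\<ge>1. nnexp M (\<lambda>\<omega>. g (z (t + 1) \<omega>) - gstar) \<le>
            ennreal (4 / (real t + 2)\<^sup>2) * nnexp M (\<lambda>\<omega>. g (z 1 \<omega>) - gstar)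
          + ennreal (2 * (L / \<mu> + a / (\<mu> * sqrt (real N0))) / (real t + 2)\<^sup>2)
              * nnexp M (\<lambda>\<omega>. (norm (s 1 \<omega> - x))\<^sup>2)
          + ennreal ((L / \<mu> + a / (\<mu> * sqrt (real N0)))
              * (3 * \<mu>\<^sup>2 / (4 * (1 - \<mu>) * a\<^sup>2 * b * (ln (2 + \<delta>)) powr (2 * b)))
              / (real t + 2)\<^sup>2) * (\<sigma> x)\<^sup>2
          + ennreal ((L / \<mu> + a / (\<mu> * sqrt (real N0)))
              * (15 * \<mu>\<^sup>2 / (4 * (1 - \<mu>) * real N0 * b * (ln (2 + \<delta>)) powr (2 * b)))
              * ((\<sigma>\<^sub>L / L)\<^sup>2 * J / (real t + 2)\<^sup>2)))))"
  proof -
  interpret P: prob_space P by (rule P)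
  interpret M: prob_space M by (rule M)
  have X_ne: "X \<noteq> {}" using initial(1) by auto
  \<comment> \<open>\<open>F_regular\<close> holds only almost everywhere, and the exceptional set need not be
     measurable, so it is enlarged to a null set.\<close>
  obtain bad where bad: "{\<zeta> \<in> space P. \<not> continuous_on X (\<lambda>x. gradF x \<zeta>)} \<subseteq> bad" "bad \<in> null_sets P"
  proof -
    have "AE \<zeta> in P. continuous_on X (\<lambda>x. gradF x \<zeta>)" using F_regular by eventually_elim simp
    then show ?thesis using that unfolding eventually_ae_filter by blast
  qed
  define G where "G u \<zeta> = (if \<zeta> \<in> bad then 0 else gradF (closest_point X u) \<zeta>)" for u \<zeta>
  have cont: "continuous_on X (\<lambda>x. gradF x \<zeta>)" if "\<zeta> \<in> space P - bad" for \<zeta>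
    using bad(1) that by auto
  note version = oracle_version_jointly_measurable[OF X X_ne gradF_integrable bad(2) cont, folded G_def]
  define A where "A = \<mu> / (L + a / sqrt (real N0))"
  have \<alpha>: "\<alpha> t = A" if "1 \<le> t" for t using \<alpha>_choice[OF that] by (simp add: A_def)
  note A = stepsize_bounds[OF parameters(1) L parameters(3,6), folded A_def]
  have LA: "L * A < 1" using A(2) parameters(2) by simp
  have lnpos: "ln (real t + 2 + \<delta>) > 0" for t using parameters(5) by simp
  have N_pos: "1 \<le> N t" if "1 \<le> t" for t
  proof -
    have "0 < (real t + 2 + \<delta>) ^ 3 * (ln (real t + 2 + \<delta>)) powr (1 + 2 * b)"
      using lnpos[of t] parameters(5) by (intro mult_pos_pos zero_less_power) auto
    then have "0 < N t" unfolding N_choice[OF that] using parameters(6) by simp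
    then show ?thesis by simp
  qed
  interpret R: accelerated_run M P \<xi> N G X f \<phi> gradf gradF bad L \<alpha> \<beta> z0 y z
  proof unfold_locales
    show "prob_space.indep_vars M (\<lambda>_. P) (\<lambda>(t, j). \<xi> t j) {(t, j). 1 \<le> t \<and> 1 \<le> j \<and> j \<le> N t}"
      by (rule sample_indep)
    show "distr M P (case i of (t, j) \<Rightarrow> \<xi> t j) = P" if "i \<in> {(t, j). 1 \<le> t \<and> 1 \<le> j \<and> j \<le> N t}" for i
      using that sample_distr by auto
    show "(\<lambda>(u, \<zeta>). G u \<zeta>) \<in> borel_measurable (borel \<Otimes>\<^sub>M P)" by (rule version(1))
    show "integrable P (G u)" for u by (rule version(2))
    show "bad \<in> null_sets P" by (rule bad(2))
    show "G u \<zeta> = gradF u \<zeta>" if "u \<in> X" "\<zeta> \<in> space P - bad" for u \<zeta>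
      using that closest_point_self[OF that(1)] by (simp add: G_def)
    show "(LINT \<zeta>|P. G u \<zeta>) = gradf u" if "u \<in> X" for u
      using version(3)[OF _ _ that] by (simp add: gradf_def)
    show "convex_on X f" by (rule f_convex)
    show "convex_on X \<phi>" by (rule \<phi>_convex)
    show "(f has_derivative (\<lambda>h. inner (gradf u) h)) (at u within X)" if "u \<in> X" for u
      by (rule f_derivative[OF that])
    show "norm (gradf u - gradf u') \<le> L * norm (u - u')" if "u \<in> X" "u' \<in> X" for u u'
      by (rule f_smooth[OF that])
    show "0 < \<alpha> t" "L * \<alpha> t < 1" if "1 \<le> t" for t using A(1) LA \<alpha>[OF that] by auto
    show "\<alpha> (t + 1) \<le> \<alpha> t" if "1 \<le> t" for t by (rule \<alpha>_nonincreasing[OF that])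
    show "\<beta> 1 = 1" using \<beta>_choice[of 1] by simp
    show "1 \<le> \<beta> t" if "1 \<le> t" for t by (rule \<beta>_ge_1[OF that])
    show "(\<beta> (t + 1))\<^sup>2 - \<beta> (t + 1) \<le> (\<beta> t)\<^sup>2" if "1 \<le> t" for t by (rule \<beta>_recursion[OF that])
    show "1 \<le> N t" if "1 \<le> t" for t by (rule N_pos[OF that])
    show "z0 \<in> X" by (rule initial(1))
    show "z 0 \<omega> = z0" if "\<omega> \<in> space M" for \<omega> by (rule initial(2)[OF that])
    show "y 1 \<omega> = z0" if "\<omega> \<in> space M" for \<omega> by (rule initial(3)[OF that])
    show "y t \<omega> \<in> X" if "1 \<le> t" "\<omega> \<in> space M" for t \<omega> by (rule y_in_X[OF that])
    show "is_arg_min (prox_model f \<phi> (\<alpha> t) (y t \<omega>) (minibatch gradF (N t) (\<lambda>j. \<xi> t j \<omega>) (y t \<omega>))) (\<lambda>x. x \<in> X) (z t \<omega>)"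
      if "1 \<le> t" "\<omega> \<in> space M" for t \<omega> by (rule z_step[OF that])
    show "y (t + 1) \<omega> = ((\<beta> t - 1) / \<beta> (t + 1)) *\<^sub>R (z t \<omega> - z (t - 1) \<omega>) + z t \<omega>"
      if "1 \<le> t" "\<omega> \<in> space M" for t \<omega> by (rule y_step[OF that])
  qed
  have g_eq: "R.g = g" by (simp add: R.g_def g_def fun_eq_iff)

  define V where "V u = nnexp P (\<lambda>\<xi>. (norm (gradF u \<xi> - gradf u))\<^sup>2)" for u
  define sd where "sd u = sqrt (enn2real (V u))" for u
  have sd0: "sd u \<ge> 0" for u by (simp add: sd_def)
  have \<sigma>_eq: "\<sigma> u = (if V u = \<infinity> then \<infinity> else ennreal (sd u))" for u
    unfolding \<sigma>_def noise_sd_def V_def[symmetric] sd_def by (simp add: Let_def)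
  have V_fin: "V u < \<infinity>" if u: "u \<in> X" for u
  proof -
    obtain x0 where x0: "x0 \<in> X" "\<sigma> x0 < \<infinity>" using \<sigma>_finite by blast
    have "\<sigma> u \<le> \<sigma> x0 + ennreal (\<sigma>\<^sub>L * norm (u - x0))" by (rule \<sigma>_multiplicative[OF u x0(1)])
    also have "\<dots> < \<infinity>" using x0(2) by simp
    finally show ?thesis by (auto simp: \<sigma>_eq less_top split: if_splits)
  qed
  have \<sigma>_sd: "\<sigma> u = ennreal (sd u)" if "u \<in> X" for u
    using V_fin[OF that] by (simp add: \<sigma>_eq)
  have V_sd: "V u = ennreal ((sd u)\<^sup>2)" if "u \<in> X" for u
    using V_fin[OF that] by (simp add: sd_def less_top)
  have sd_mult: "sd u \<le> sd x + \<sigma>\<^sub>L * norm (u - x)" if "u \<in> X" "x \<in> X" for u x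
  proof -
    have "ennreal (sd u) \<le> ennreal (sd x) + ennreal (\<sigma>\<^sub>L * norm (u - x))"
      using \<sigma>_multiplicative[OF that] by (simp add: \<sigma>_sd that)
    also have "\<dots> = ennreal (sd x + \<sigma>\<^sub>L * norm (u - x))"
      using sd0 \<sigma>\<^sub>L by (intro ennreal_plus[symmetric]) auto
    finally show ?thesis using sd0[of x] \<sigma>\<^sub>L by (subst (asm) ennreal_le_iff) auto
  qed
  have var: "R.oracle_var u \<le> ennreal ((sd x + \<sigma>\<^sub>L * norm (u - x))\<^sup>2)" if "u \<in> X" "x \<in> X" for u x
  proof -
    have mean: "R.mean u = gradf u" using R.G_mean[OF that(1)] by (simp add: R.mean_def)
    have "R.oracle_var u = V u"
      unfolding R.oracle_var_def V_def mean
    proof (rule nn_integral_cong_AE)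
      show "AE \<zeta> in P. ennreal ((norm (G u \<zeta> - gradf u))\<^sup>2) = ennreal ((norm (gradF u \<zeta> - gradf u))\<^sup>2)"
        using AE_not_in[OF bad(2)] AE_space by eventually_elim (simp add: R.G_eq[OF that(1)])
    qed
    also have "\<dots> \<le> ennreal ((sd x + \<sigma>\<^sub>L * norm (u - x))\<^sup>2)"
      unfolding V_sd[OF that(1)] by (intro ennreal_leI power_mono sd_mult that sd0)
    finally show ?thesis .
  qed

  let ?c = "series_term \<alpha> \<beta> N L"
  have step_eq: "(\<alpha> (t + 1))\<^sup>2 * (\<beta> (t + 1))\<^sup>2 / (1 - L * \<alpha> (t + 1)) / real (N (t + 1)) = ?c t" for t
    by (simp add: series_term_def)
  have tail: "?c t \<ge> 0" "?c summable_on {p..}"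
    "infsum ?c {p..} \<le> A\<^sup>2 / (8 * (1 - L * A) * real N0 * b * ln (real p + 2 + \<delta>) powr (2 * b))" for t p
    by (rule series_term_tail[OF A(1) LA parameters(4,5,6) \<alpha> \<beta>_choice N_choice]; assumption)+
  have partial: "sum ?c {p..<q} \<le> infsum ?c {p..}" for p q
    by (rule finite_sum_le_infsum[OF tail(2)]) (use tail(1) in auto)
  have t0: "t0 \<ge> 1" by (simp add: t0_def burn_in_def)
  have growth: "\<beta> t - 1 \<le> \<beta> (t + 1)" if "1 \<le> t" for t
    using \<beta>_choice[OF that] \<beta>_choice[of "t + 1"] by simp

  have burn_in_tail: "infsum ?c {t0..} < 1 / (15 * \<sigma>\<^sub>L\<^sup>2)" if \<theta>_le: "\<theta> \<le> 1 - L * \<alpha> 1"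
  proof -
    have \<alpha>1: "\<alpha> 1 = A" by (rule \<alpha>) simp
    define W where "W = ln (real t0 + 2 + \<delta>) powr (2 * b)"
    \<comment> \<open>Writing \<open>r\<close> for the number whose root defines the burn-in time,
       \<open>A\<^sup>2 / (m * r)\<close> is exactly the threshold \<open>1 / (15 *
       \<sigma>\<^sub>L\<^sup>2)\<close>.\<close>
    define m where "m = 8 * \<theta> * real N0 * b"
    define k where "k = 8 * (1 - L * A) * real N0 * b"
    define r where "r = 15 * (A * \<sigma>\<^sub>L)\<^sup>2 / m"
    have m: "m > 0" using \<theta> parameters by (simp add: m_def)
    then have r: "r > 0" using A(1) \<sigma>\<^sub>L by (simp add: r_def)
    have W: "r < W"
      unfolding r_def m_def W_def t0_def \<alpha>1
      by (rule burn_in_log_power) (use A(1) \<sigma>\<^sub>L \<theta> parameters in auto)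
    have mk: "m \<le> k"
      unfolding m_def k_def using \<theta>_le[unfolded \<alpha>1] parameters by (auto intro!: mult_right_mono)
    have "infsum ?c {t0..} \<le> A\<^sup>2 / (k * W)" unfolding k_def W_def by (rule tail(3))
    also have "\<dots> < A\<^sup>2 / (m * r)"
      using A(1) m r W mk by (intro divide_strict_left_mono mult_le_less_imp_less mult_pos_pos) auto
    also have "\<dots> = 1 / (15 * \<sigma>\<^sub>L\<^sup>2)"
      using A(1) m by (simp add: r_def power_mult_distrib)
    finally show ?thesis .
  qed

  have optimal: "x \<in> X" "\<And>u. u \<in> X \<Longrightarrow> R.g x \<le> R.g u" "gstar = g x" if "x \<in> S" for x
  proof -
    show x: "x \<in> X" and min: "\<And>u. u \<in> X \<Longrightarrow> R.g x \<le> R.g u"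
      using that by (auto simp: S_def g_eq is_arg_min_linorder)
    show "gstar = g x"
      unfolding gstar_def using x min by (intro cInf_eq_minimum) (auto simp: g_eq)
  qed
  have gap: "R.gap x t = nnexp M (\<lambda>\<omega>. g (z t \<omega>) - gstar)" if "x \<in> S" for x t
    by (simp add: R.gap_def g_eq optimal(3)[OF that])
  have momentum: "R.momentum_dist x t = nnexp M (\<lambda>\<omega>. (norm (s t \<omega> - x))\<^sup>2)" if "t \<ge> 1" for x t
    unfolding R.momentum_dist_def using that by (intro nn_integral_cong) (simp add: R.momentum_def s_def)
  have lyap: "R.lyapunov x t = ennreal (2 * \<alpha> t * (\<beta> t)\<^sup>2) * nnexp M (\<lambda>\<omega>. g (z t \<omega>) - gstar)
      + nnexp M (\<lambda>\<omega>. (norm (s t \<omega> - x))\<^sup>2)" if "x \<in> S" "t \<ge> 1" for x t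
    using that by (simp add: R.lyapunov_def gap momentum R.weight_def)

  have finite_moments: "nnexp M (\<lambda>\<omega>. g (z t \<omega>) - gstar) < \<infinity> \<and> nnexp M (\<lambda>\<omega>. (norm (s t \<omega> - x))\<^sup>2) < \<infinity>"
    if x: "x \<in> S" and t: "t \<ge> 1" for x t
    using R.gap_finite[OF optimal(1,2)[OF x] var[OF _ optimal(1)[OF x]] sd0 less_imp_le[OF \<sigma>\<^sub>L] t]
    by (simp add: gap[OF x] momentum[OF t])

  have bounded: "(SUP t\<in>{1..}. nnexp M (\<lambda>\<omega>. (norm (z t \<omega> - x))\<^sup>2)) \<le>
      ((MAX t\<in>{1..t0}. ennreal (2 * \<alpha> t * (\<beta> t)\<^sup>2) * nnexp M (\<lambda>\<omega>. g (z t \<omega>) - gstar)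
          + nnexp M (\<lambda>\<omega>. (norm (s t \<omega> - x))\<^sup>2)) + (\<sigma> x)\<^sup>2 / ennreal (3 * \<sigma>\<^sub>L\<^sup>2))
      / ennreal (1 - 15 * \<gamma> * \<sigma>\<^sub>L\<^sup>2)"
    if x: "x \<in> S" and \<gamma>: "infsum ?c {t0..} < \<gamma>" "\<gamma> < 1 / (15 * \<sigma>\<^sub>L\<^sup>2)" for x \<gamma>
  proof (rule SUP_least)
    fix t :: nat assume "t \<in> {1..}"
    then have t: "t \<ge> 1" by simp
    have sums: "(\<Sum>t = t0..<q. (\<alpha> (t + 1))\<^sup>2 * (\<beta> (t + 1))\<^sup>2 / (1 - L * \<alpha> (t + 1)) / real (N (t + 1))) \<le> \<gamma>" for q
      unfolding step_eq using partial[of t0 q] \<gamma>(1) by simp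
    have MAX_eq: "(MAX t\<in>{1..t0}. R.lyapunov x t) = (MAX t\<in>{1..t0}. ennreal (2 * \<alpha> t * (\<beta> t)\<^sup>2) * nnexp M (\<lambda>\<omega>. g (z t \<omega>) - gstar)
          + nnexp M (\<lambda>\<omega>. (norm (s t \<omega> - x))\<^sup>2))"
      by (rule arg_cong[where f = Max], rule image_cong) (simp_all add: lyap[OF x])
    have "(\<sigma> x)\<^sup>2 = ennreal ((sd x)\<^sup>2)"
      using \<sigma>_sd[OF optimal(1)[OF x]] sd0[of x] by (simp add: ennreal_power)
    then show "nnexp M (\<lambda>\<omega>. (norm (z t \<omega> - x))\<^sup>2) \<le>
      ((MAX t\<in>{1..t0}. ennreal (2 * \<alpha> t * (\<beta> t)\<^sup>2) * nnexp M (\<lambda>\<omega>. g (z t \<omega>) - gstar)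
          + nnexp M (\<lambda>\<omega>. (norm (s t \<omega> - x))\<^sup>2)) + (\<sigma> x)\<^sup>2 / ennreal (3 * \<sigma>\<^sub>L\<^sup>2))
      / ennreal (1 - 15 * \<gamma> * \<sigma>\<^sub>L\<^sup>2)"
      using R.iterate_dist_bound[OF optimal(1,2)[OF x] var[OF _ optimal(1)[OF x]] sd0 \<sigma>\<^sub>L growth t0 sums \<gamma>(2) t]
      unfolding MAX_eq R.iterate_dist_def by simp
  qed

  have rate: "nnexp M (\<lambda>\<omega>. g (z (t + 1) \<omega>) - gstar) \<le>
            ennreal (4 / (real t + 2)\<^sup>2) * nnexp M (\<lambda>\<omega>. g (z 1 \<omega>) - gstar)
          + ennreal (2 * (L / \<mu> + a / (\<mu> * sqrt (real N0))) / (real t + 2)\<^sup>2)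
              * nnexp M (\<lambda>\<omega>. (norm (s 1 \<omega> - x))\<^sup>2)
          + ennreal ((L / \<mu> + a / (\<mu> * sqrt (real N0)))
              * (3 * \<mu>\<^sup>2 / (4 * (1 - \<mu>) * a\<^sup>2 * b * (ln (2 + \<delta>)) powr (2 * b)))
              / (real t + 2)\<^sup>2) * (\<sigma> x)\<^sup>2
          + ennreal ((L / \<mu> + a / (\<mu> * sqrt (real N0)))
              * (15 * \<mu>\<^sup>2 / (4 * (1 - \<mu>) * real N0 * b * (ln (2 + \<delta>)) powr (2 * b)))
              * ((\<sigma>\<^sub>L / L)\<^sup>2 * J / (real t + 2)\<^sup>2))"
    if x: "x \<in> S" and J: "J > 0" "(SUP \<tau>\<in>{1..}. nnexp M (\<lambda>\<omega>. (norm (z \<tau> \<omega> - x))\<^sup>2)) \<le> ennreal J"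
      and t: "t \<ge> 1" for x J t
  proof -
    define W where "W = ln (2 + \<delta>) powr (2 * b)"
    have W: "W > 0" using parameters(5) by (simp add: W_def)
    \<comment> \<open>A bound for the whole series; the lower end \<open>3 + \<delta>\<close> of the logarithms
       is relaxed to \<open>2 + \<delta>\<close>.\<close>
    define \<Gamma> where "\<Gamma> = A\<^sup>2 / (8 * (1 - L * A) * real N0 * b * W)"
    have \<Gamma>_nonneg: "\<Gamma> \<ge> 0" using LA parameters W by (simp add: \<Gamma>_def)
    have "W \<le> ln (real 1 + 2 + \<delta>) powr (2 * b)"
      unfolding W_def using parameters(4,5) by (intro powr_mono2) auto
    then have "A\<^sup>2 / (8 * (1 - L * A) * real N0 * b * ln (real 1 + 2 + \<delta>) powr (2 * b)) \<le> \<Gamma>"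
      unfolding \<Gamma>_def using W LA parameters by (intro divide_left_mono mult_left_mono mult_pos_pos) auto
    then have \<Gamma>: "(\<Sum>\<tau> = 1..<Suc t. (\<alpha> (\<tau> + 1))\<^sup>2 * (\<beta> (\<tau> + 1))\<^sup>2 / (1 - L * \<alpha> (\<tau> + 1)) / real (N (\<tau> + 1))) \<le> \<Gamma>"
      unfolding step_eq using partial[of 1 "Suc t"] tail(3)[of 1] by linarith
    have \<Gamma>_a: "\<Gamma> \<le> \<mu>\<^sup>2 / (8 * (1 - \<mu>) * a\<^sup>2 * b * W)"
    proof -
      have "\<Gamma> \<le> (\<mu>\<^sup>2 * real N0 / a\<^sup>2) / (8 * (1 - \<mu>) * real N0 * b * W)"
        unfolding \<Gamma>_def using A(2,3) W parameters
        by (intro frac_le mult_right_mono mult_left_mono mult_pos_pos) auto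
      also have "\<dots> = \<mu>\<^sup>2 / (8 * (1 - \<mu>) * a\<^sup>2 * b * W)" using parameters(6) by simp
      finally show ?thesis .
    qed
    have \<Gamma>_L: "\<Gamma> \<le> (\<mu>\<^sup>2 / L\<^sup>2) / (8 * (1 - \<mu>) * real N0 * b * W)"
      unfolding \<Gamma>_def using A(2,4) W parameters
      by (intro frac_le mult_right_mono mult_left_mono mult_pos_pos) auto
    define \<kappa> where "\<kappa> = L / \<mu> + a / (\<mu> * sqrt (real N0))"
    have \<kappa>: "\<kappa> = 1 / A" by (simp only: A(5) \<kappa>_def)
    then have \<kappa>_pos: "\<kappa> > 0" using A(1) by simp
    define T where "T = (real t + 2)\<^sup>2"
    have T: "T > 0" by (simp add: T_def)
    \<comment> \<open>\<open>w\<close> is the weight of the function gap at time \<open>t + 1\<close>; dividing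
       by it turns the Lyapunov bound into the rate.\<close>
    define w where "w = A * T / 2"
    have w: "w > 0" using A(1) T by (simp add: w_def)
    have inv_w: "1 / w = 2 * \<kappa> / T" by (simp add: w_def \<kappa>)
    have weight: "R.weight (t + 1) = w"
    proof -
      have "\<alpha> (t + 1) = A" "\<beta> (t + 1) = (real t + 2) / 2"
        using \<alpha>[of "t + 1"] \<beta>_choice[of "t + 1"] by simp_all
      then have "R.weight (t + 1) = 2 * A * ((real t + 2) / 2)\<^sup>2" by (simp only: R.weight_def) simp
      then show ?thesis by (simp add: w_def T_def power_divide)
    qed
    let ?g = "\<lambda>t. nnexp M (\<lambda>\<omega>. g (z t \<omega>) - gstar)" and ?s = "nnexp M (\<lambda>\<omega>. (norm (s 1 \<omega> - x))\<^sup>2)"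
    have dist_J: "R.iterate_dist x \<tau> \<le> ennreal J" if "\<tau> \<ge> 1" for \<tau>
      unfolding R.iterate_dist_def using J(2) that by (meson SUP_le_iff atLeast_iff)
    define Q where "Q = \<Gamma> * (3 * (sd x)\<^sup>2 + 15 * \<sigma>\<^sub>L\<^sup>2 * J)"
    have Q: "Q \<ge> 0" using \<Gamma>_nonneg J(1) by (simp add: Q_def)
    have Q_le: "ennreal (1 / w * Q)
        \<le> ennreal (\<kappa> * (3 * \<mu>\<^sup>2 / (4 * (1 - \<mu>) * a\<^sup>2 * b * W)) / T * (sd x)\<^sup>2
            + \<kappa> * (15 * \<mu>\<^sup>2 / (4 * (1 - \<mu>) * real N0 * b * W)) * ((\<sigma>\<^sub>L / L)\<^sup>2 * J / T))"
    proof (rule ennreal_leI)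
      have "1 / w * Q = (6 * \<kappa> / T * (sd x)\<^sup>2) * \<Gamma> + (30 * \<kappa> / T * \<sigma>\<^sub>L\<^sup>2 * J) * \<Gamma>"
        unfolding inv_w Q_def by (simp add: algebra_simps add_divide_distrib)
      also have "\<dots> \<le> (6 * \<kappa> / T * (sd x)\<^sup>2) * (\<mu>\<^sup>2 / (8 * (1 - \<mu>) * a\<^sup>2 * b * W))
          + (30 * \<kappa> / T * \<sigma>\<^sub>L\<^sup>2 * J) * ((\<mu>\<^sup>2 / L\<^sup>2) / (8 * (1 - \<mu>) * real N0 * b * W))"
        using \<kappa>_pos T J(1) by (intro add_mono mult_left_mono \<Gamma>_a \<Gamma>_L) auto
      also have "\<dots> = \<kappa> * (3 * \<mu>\<^sup>2 / (4 * (1 - \<mu>) * a\<^sup>2 * b * W)) / T * (sd x)\<^sup>2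
            + \<kappa> * (15 * \<mu>\<^sup>2 / (4 * (1 - \<mu>) * real N0 * b * W)) * ((\<sigma>\<^sub>L / L)\<^sup>2 * J / T)"
      proof -
        have "(6 * k / T' * v) * (m / (8 * n * c * b' * W')) = k * (3 * m / (4 * n * c * b' * W')) / T' * v"
          for k T' v m n c b' W' :: real
          by (simp add: mult_ac)
        moreover have "(30 * k / T' * v * J') * (m / l / (8 * n * c * b' * W')) = k * (15 * m / (4 * n * c * b' * W')) * (v / l * J' / T')"
          for k T' v J' m l n c b' W' :: real
          by (simp add: mult_ac)
        ultimately show ?thesis by (simp only: power_divide)
      qed
      finally show "1 / w * Q \<le> \<dots>" .
    qed
    have "ennreal w * ?g (t + 1) \<le> ennreal (2 * A) * ?g 1 + ?s + ennreal Q"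
      using R.gap_bound[OF optimal(1,2)[OF x] var[OF _ optimal(1)[OF x]] sd0 less_imp_le[OF \<sigma>\<^sub>L] growth dist_J less_imp_le[OF J(1)] \<Gamma> t]
        \<alpha>[of 1] \<beta>_choice[of 1]
      by (simp add: Q_def weight[simplified] gap[OF x] lyap[OF x])
    then have "ennreal (1 / w) * (ennreal w * ?g (t + 1)) \<le> ennreal (1 / w) * (ennreal (2 * A) * ?g 1 + ?s + ennreal Q)"
      by (rule mult_left_mono) simp
    also have "ennreal (1 / w) * (ennreal w * ?g (t + 1)) = ?g (t + 1)"
      using w by (simp add: mult.assoc[symmetric] ennreal_mult[symmetric])
    also have "ennreal (1 / w) * (ennreal (2 * A) * ?g 1 + ?s + ennreal Q)
        = ennreal (1 / w * (2 * A)) * ?g 1 + ennreal (1 / w) * ?s + ennreal (1 / w * Q)"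
      using w A(1) Q by (simp only: distrib_left mult.assoc[symmetric]) (simp add: ennreal_mult[symmetric])
    also have "1 / w * (2 * A) = 4 / T" using A(1) by (simp add: w_def)
    finally have "?g (t + 1) \<le> ennreal (4 / T) * ?g 1 + ennreal (1 / w) * ?s + ennreal (1 / w * Q)" .
    also note add_left_mono[OF Q_le]
    also have "ennreal (\<kappa> * (3 * \<mu>\<^sup>2 / (4 * (1 - \<mu>) * a\<^sup>2 * b * W)) / T * (sd x)\<^sup>2
            + \<kappa> * (15 * \<mu>\<^sup>2 / (4 * (1 - \<mu>) * real N0 * b * W)) * ((\<sigma>\<^sub>L / L)\<^sup>2 * J / T))
        = ennreal (\<kappa> * (3 * \<mu>\<^sup>2 / (4 * (1 - \<mu>) * a\<^sup>2 * b * W)) / T) * (\<sigma> x)\<^sup>2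
          + ennreal (\<kappa> * (15 * \<mu>\<^sup>2 / (4 * (1 - \<mu>) * real N0 * b * W)) * ((\<sigma>\<^sub>L / L)\<^sup>2 * J / T))"
    proof -
      have "0 \<le> \<kappa> * (3 * \<mu>\<^sup>2 / (4 * (1 - \<mu>) * a\<^sup>2 * b * W)) / T"
        "0 \<le> \<kappa> * (15 * \<mu>\<^sup>2 / (4 * (1 - \<mu>) * real N0 * b * W)) * ((\<sigma>\<^sub>L / L)\<^sup>2 * J / T)"
        using \<kappa>_pos T W J(1) parameters by auto
      moreover have "(\<sigma> x)\<^sup>2 = ennreal ((sd x)\<^sup>2)"
        using \<sigma>_sd[OF optimal(1)[OF x]] sd0[of x] by (simp add: ennreal_power)
      ultimately show ?thesis by (simp only: ennreal_plus ennreal_mult zero_le_power2 mult_nonneg_nonneg)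
    qed
    finally show ?thesis
      unfolding inv_w \<kappa>_def[symmetric] T_def[symmetric] W_def[symmetric]
      by (simp only: add.assoc)
  qed

  show ?thesis
    using tail(2) burn_in_tail finite_moments bounded rate by blast
qed

end
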